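(* In the setting of the context (interior maximum), the random vector $Z(N)=\sqrt N\,(x^*-X(N))$ converges weakly, as $N\to\infty$, to the normal distribution $\mathcal{N}\big(0,-D^2f(x^* )^{-1}\big)$, and its moment generating function $M_{Z(N)}(\xi)=\mathbb{E}\,e^{\xi^TZ(N)}$ satisfies, for each fixed $\xi\in\mathbb{R}^m$, $$M_{Z(N)}(\xi)=\exp\Big(-\tfrac12\xi^TD^2f(x^* )^{-1}\xi\Big)\bigg(1+\frac{O(1)}{\sqrt N}+\epsilon(N)\sqrt N\,O(1)\bigg),\qquad N\to\infty .$$
   Context: $\mathbb{Z}_+$ is the set of positive integers. $\Omega\subset\mathbb{R}^m$ is open and bounded, and $\Omega'\subset\Omega$ is the closed ball centered at the origin with radius $\varepsilon>0$. $f:\Omega\times\mathbb{Z}_+\to\mathbb{R}$ is such that $f(\cdot,N)$ and its $x$-derivatives up to third order exist on $\Omega'$ and are bounded there uniformly in $x$ and $N$, and the Hessian $D^2f(x,N)$ is nonsingular there. There is $N_0\in\mathbb{Z}_+$ such that for all $N\ge N_0$ the function $f(\cdot,N)$ has a unique maximum on $\Omega$, attained at $x^*(N)$ in the interior of $\Omega'$, with $$\Delta:=\inf_{N\ge N_0,\ x\in\Omega\setminus\Omega'}\{f(x^*(N),N)-f(x,N)\}>0 .$$ The origin of coordinates is $x^*=\lim_{N\to\infty}x^*(N)$. Moreover $\inf_{x\in\Omega',N\ge N_0}\|D^2f(x,N)^{-1/2}\|^{-2}>0$ (the quantity being the smallest absolute value of an eigenvalue of $D^2f(x,N)$), $\inf_{x\in\Omega',N\ge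 N_0}\sqrt{|\det D^2f(x,N)|}>0$, $\sup_{x\in\Omega',N\ge N_0}\|D^2f(x,N)\|<\infty$, $\sup_{x\in\Omega',N\ge N_0}\|D^3f(x,N)\|<\infty$. The integrals $\int_\Omega e^{Nf(x,N)}dx$ exist and are finite, and there is a constant $C>0$ with $C\ge\int_\Omega e^{N_0f(x,N)}dx$ for all $N\ge N_0$. In addition $f(x,N)=f(x)+\epsilon(N)\sigma(x)$, where $f,\sigma$ are functions of $x$ with derivatives up to second order at $x^*$, the Hessian $D^2f(x^* )$ is nonsingular, $\epsilon(N)>0$ and $\epsilon(N)=o(1/\sqrt N)$ as $N\to\infty$. For $N\ge N_0$, $X(N)$ is the random vector with values in $\Omega$ and distribution $$P_N(X(N)\in A)=\frac{\int_Ae^{Nf(x,N)}dx}{\int_{\Omega}e^{Nf(x,N)}dx},\qquad A\in\mathcal{B}(\Omega)\ \text{(Borel sets)}.$$ *)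

theory Defs
  imports "HOL-Probability.Probability" "HOL-Library.Landau_Symbols"
begin

(* The Frechet derivative relative to S, packaged as a bounded linear map so that it can be
   iterated: Dwithin S (Dwithin S g) x is the second derivative as a bilinear map, and the norm
   of an iterated derivative is the operator norm of the corresponding multilinear map. Only
   meaningful where g is differentiable within S and the derivative is unique (interior points,
   or all points of a ball of positive radius). *)
definition Dwithin ::
  "'a::real_normed_vector set \<Rightarrow> ('a \<Rightarrow> 'b::real_normed_vector) \<Rightarrow> 'a \<Rightarrow> ('a \<Rightarrow>\<^sub>L 'b)"
  where "Dwithin S g x = Blinfun (frechet_derivative g (at x within S))"

definition three_times_differentiable_on ::
  "('a::real_normed_vector \<Rightarrow> real) \<Rightarrow> 'a set \<Rightarrow> bool"
  where "three_times_differentiable_on g S \<longleftrightarrow>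
    g differentiable_on S \<and> Dwithin S g differentiable_on S \<and>
    Dwithin S (Dwithin S g) differentiable_on S"

definition twice_differentiable_at :: "('a::real_normed_vector \<Rightarrow> real) \<Rightarrow> 'a \<Rightarrow> bool"
  where "twice_differentiable_at g x \<longleftrightarrow>
    (\<forall>\<^sub>F y in nhds x. g differentiable (at y)) \<and> Dwithin UNIV g differentiable (at x)"

definition hessian_within :: "(real^'m) set \<Rightarrow> (real^'m \<Rightarrow> real) \<Rightarrow> real^'m \<Rightarrow> real^'m^'m"
  where "hessian_within S g x =
    (\<chi> i j. blinfun_apply (blinfun_apply (Dwithin S (Dwithin S g) x) (axis i 1)) (axis j 1))"

abbreviation hessian :: "(real^'m \<Rightarrow> real) \<Rightarrow> real^'m \<Rightarrow> real^'m^'m"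
  where "hessian \<equiv> hessian_within UNIV"

definition real_eigenvalues :: "real^'m^'m \<Rightarrow> real set"
  where "real_eigenvalues A = {c. \<exists>v. v \<noteq> 0 \<and> A *v v = c *\<^sub>R v}"

(* For a symmetric nonsingular A this is the spectral-norm quantity norm (A^(-1/2)) ^ (-2). *)
definition min_abs_eigenvalue :: "real^'m^'m \<Rightarrow> real"
  where "min_abs_eigenvalue A = Min (abs ` real_eigenvalues A)"

(* Weak convergence of Borel measures; weak_conv_m of the library covers the real line only. *)
definition weakly_converges ::
  "(nat \<Rightarrow> 'a::topological_space measure) \<Rightarrow> 'a measure \<Rightarrow> bool"
  where "weakly_converges \<mu> \<nu> \<longleftrightarrow>
    (\<forall>g::'a \<Rightarrow> real. continuous_on UNIV g \<and> bounded (range g) \<longrightarrow>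
      (\<lambda>n. \<integral>x. g x \<partial>\<mu> n) \<longlonglongrightarrow> (\<integral>x. g x \<partial>\<nu>))"

(* Mean a, covariance matrix S; intended for positive definite S. *)
definition multivariate_normal :: "real^'m \<Rightarrow> real^'m^'m \<Rightarrow> (real^'m) measure"
  where "multivariate_normal a S = density lborel (\<lambda>x. ennreal
    (exp (- (1/2) * ((x - a) \<bullet> (matrix_inv S *v (x - a)))) /
      sqrt ((2 * pi) ^ CARD('m) * det S)))"

definition moment_generating_function ::
  "'w measure \<Rightarrow> ('w \<Rightarrow> 'a::real_inner) \<Rightarrow> 'a \<Rightarrow> real"
  where "moment_generating_function M Z \<xi> = (\<integral>\<omega>. exp (\<xi> \<bullet> Z \<omega>) \<partial>M)"

end

theory Submission
  imports Defs
begin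

text \<open>
  This is Laplace's method with a moving maximum, quantified by one pointwise estimate.

  Write \<open>p = xs N\<close> and substitute \<open>x = p - y / sqrt N\<close>. The law of \<open>Z N + sqrt N *\<^sub>R p\<close> then has the
  density \<open>q N / integral of q N\<close>, where \<open>q N y = exp (N * (f x N - f p N))\<close> on the rescaled domain and
  \<open>0\<close> elsewhere (\<open>expectation_rescaled\<close>). Let \<open>D\<close> be the second derivative of \<open>f0\<close> at the origin
  and \<open>\<gamma> y = exp (D y y / 2)\<close>. The claim behind everything is
  \<open>\<bar>q N y - \<gamma> y\<bar> \<le> K * (1 / sqrt N + \<epsilon> N) * (1 + norm y ^ 3) * exp (- k * (norm y)\<^sup>2)\<close>
  for all \<open>y\<close> and all large \<open>N\<close>,
  see \<open>rescaled_density_estimate\<close>. Integrating it against \<open>exp (\<xi> \<bullet> y)\<close>, or against a bounded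
  function, gives normalized integrals up to \<open>O(1 / sqrt N + \<epsilon> N)\<close>
  (\<open>normalized_integral_perturbation\<close>). The remaining shift \<open>sqrt N *\<^sub>R p\<close> is \<open>O(\<epsilon> N * sqrt N)\<close>, and
  it tends to \<open>0\<close>.

  Three facts about \<open>f\<close> are needed for the estimate.

  \<^item> \<open>\<lambda>x. f x N\<close> is strongly concave on the ball \<open>\<Omega>'\<close>, uniformly in \<open>N\<close>. The Hessian is negative
  semidefinite at \<open>p\<close>. Symmetric matrices that are negative semidefinite, bounded, and have determinant bounded
  away from \<open>0\<close> form a compact set and are uniformly negative definite
  (\<open>uniform_negative_definiteness\<close>). As the Hessian is Lipschitz, this gap carries definiteness
  from \<open>p\<close> to the whole ball in small steps (\<open>negative_definite_propagates\<close>). Together with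
  the gap \<open>\<Delta>\<close> outside the ball and the boundedness of \<open>\<Omega>\<close> this gives
  \<open>f x N \<le> f p N - k * (norm (x - p))\<^sup>2\<close> on all of \<open>\<Omega>\<close>, so both \<open>q N\<close> and \<open>\<gamma>\<close> are bounded by a
  fixed Gaussian.

  \<^item> The gradient of \<open>f0\<close> vanishes at the origin, so the gradient of \<open>\<lambda>x. f x N\<close> there is
  \<open>O(\<epsilon> N)\<close>, and strong concavity yields \<open>norm p = O(\<epsilon> N)\<close>.

  \<^item> The Hessian of \<open>\<lambda>x. f x N\<close> at \<open>z\<close> differs from \<open>D\<close> by \<open>O(norm (z - p) + \<epsilon> N)\<close>, which bounds
  the remainder of the second-order expansion of the exponent.

  The Gaussian integral with a general covariance matrix, needed to identify the limit with
  \<open>multivariate_normal\<close>, is computed by a linear change of variables that turns the quadratic form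
  into the standard one (\<open>gaussian_integral\<close>).
\<close>

section \<open>Linear change of variables for Lebesgue measure\<close>

text \<open>
  A well-ordered copy of a finite type: the initial segment of the natural numbers with as many
  elements as the type. The behaviour of Lebesgue measure under linear maps is proved for vectors
  indexed by a well-ordered type; reindexing along a bijection with \<open>rank_index\<close> carries it over to
  every finite index type.
\<close>

typedef ('a::finite) rank_index = "{..<CARD('a)}"
  morphisms rank_of index_of_rank
  by (rule exI[of _ 0]) simp

instance rank_index :: (finite) finite
proof
  have "(UNIV :: 'a rank_index set) = index_of_rank ` {..<CARD('a)}"
    using type_definition.univ[OF type_definition_rank_index] by blast
  then show "finite (UNIV :: 'a rank_index set)"
    by (metis finite_imageI finite_lessThan)
qed

instantiation rank_index :: (finite) linorder
begin
definition less_eq_rank_index :: "'a rank_index \<Rightarrow> 'a rank_index \<Rightarrow> bool"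
  where "less_eq_rank_index i j \<longleftrightarrow> rank_of i \<le> rank_of j"
definition less_rank_index :: "'a rank_index \<Rightarrow> 'a rank_index \<Rightarrow> bool"
  where "less_rank_index i j \<longleftrightarrow> rank_of i < rank_of j"
instance
  by standard (auto simp: less_eq_rank_index_def less_rank_index_def rank_of_inject)
end

instance rank_index :: (finite) wellorder
proof
  fix P :: "'a rank_index \<Rightarrow> bool" and a :: "'a rank_index"
  assume step: "\<And>i. (\<And>j. j < i \<Longrightarrow> P j) \<Longrightarrow> P i"
  show "P a"
  proof (induction a rule: measure_induct_rule[of rank_of])
    case (less i)
    show ?case
      by (rule step) (rule less.IH, simp add: less_rank_index_def)
  qed
qed

lemma bij_rank_index: "\<exists>\<pi> :: 'a::finite rank_index \<Rightarrow> 'a. bij \<pi>"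
proof -
  have "CARD('a rank_index) = CARD('a)"
    using type_definition.card[OF type_definition_rank_index] by auto
  then show ?thesis
    by (metis finite finite_same_card_bij)
qed

lemma swapidseq_conjugate:
  assumes "swapidseq n p" "bij \<pi>"
  shows "swapidseq n (\<pi> \<circ> p \<circ> inv \<pi>)"
  using assms(1)
proof induction
  case id
  then show ?case by (metis assms(2) bij_is_surj comp_id surj_iff swapidseq.id)
next
  case (comp_Suc n p a b)
  have "\<pi> \<circ> (Transposition.transpose a b \<circ> p) \<circ> inv \<pi> = Transposition.transpose (\<pi> a) (\<pi> b) \<circ> (\<pi> \<circ> p \<circ> inv \<pi>)"
    using assms(2) by (auto simp: fun_eq_iff Transposition.transpose_def bij_is_inj inj_eq)
  moreover have "\<pi> a \<noteq> \<pi> b" using comp_Suc assms(2) by (simp add: bij_is_inj inj_eq)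
  ultimately show ?case using comp_Suc.IH swapidseq.comp_Suc by metis
qed

lemma sign_conjugate:
  assumes "permutation p" "bij \<pi>"
  shows "sign (\<pi> \<circ> p \<circ> inv \<pi>) = sign p"
proof -
  obtain n where n: "swapidseq n p" using assms(1) unfolding permutation_def by blast
  show ?thesis
    using evenperm_unique[OF n refl] evenperm_unique[OF swapidseq_conjugate[OF n assms(2)] refl]
    by (simp add: sign_def)
qed

lemma det_reindex:
  fixes A :: "real^'m^'m" and \<pi> :: "'k::finite \<Rightarrow> 'm"
  assumes "bij \<pi>"
  shows "det (\<chi> i j. A $ \<pi> i $ \<pi> j) = det A"
proof -
  have inv: "inv \<pi> (\<pi> i) = i" "\<pi> (inv \<pi> x) = x" for i x
    using assms by (auto simp: bij_is_inj bij_is_surj surj_f_inv_f)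
  have bij_conj: "bij_betw (\<lambda>p. \<pi> \<circ> p \<circ> inv \<pi>) {p. p permutes UNIV} {q. q permutes UNIV}"
  proof (rule bij_betw_byWitness[where f'="\<lambda>q. inv \<pi> \<circ> q \<circ> \<pi>"])
    have bi: "bij (inv \<pi>)" using assms by (rule bij_imp_bij_inv)
    show "(\<lambda>p. \<pi> \<circ> p \<circ> inv \<pi>) ` {p. p permutes UNIV} \<subseteq> {q. q permutes UNIV}"
      using assms bi by (auto intro!: bij_imp_permutes bij_comp dest!: permutes_bij)
    show "(\<lambda>q. inv \<pi> \<circ> q \<circ> \<pi>) ` {q. q permutes UNIV} \<subseteq> {p. p permutes UNIV}"
      using assms bi by (auto intro!: bij_imp_permutes bij_comp dest!: permutes_bij)
  qed (auto simp: fun_eq_iff inv)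
  have "det A = (\<Sum>p | p permutes UNIV. of_int (sign (\<pi> \<circ> p \<circ> inv \<pi>)) *
      (\<Prod>x\<in>UNIV. A $ x $ (\<pi> \<circ> p \<circ> inv \<pi>) x))"
    unfolding det_def by (rule sum.reindex_bij_betw[OF bij_conj, symmetric])
  also have "\<dots> = (\<Sum>p | p permutes UNIV. of_int (sign p) * (\<Prod>i\<in>UNIV. A $ \<pi> i $ \<pi> (p i)))"
  proof (rule sum.cong[OF refl])
    fix p :: "'k \<Rightarrow> 'k" assume "p \<in> {p. p permutes UNIV}"
    then have "permutation p" using permutation_permutes finite by blast
    moreover have "(\<Prod>x\<in>UNIV. A $ x $ (\<pi> \<circ> p \<circ> inv \<pi>) x) = (\<Prod>i\<in>UNIV. A $ \<pi> i $ \<pi> (p i))"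
      using prod.reindex_bij_betw[OF assms, of "\<lambda>x. A $ x $ (\<pi> \<circ> p \<circ> inv \<pi>) x"] by (simp add: inv)
    ultimately show "of_int (sign (\<pi> \<circ> p \<circ> inv \<pi>)) * (\<Prod>x\<in>UNIV. A $ x $ (\<pi> \<circ> p \<circ> inv \<pi>) x)
      = of_int (sign p) * (\<Prod>i\<in>UNIV. A $ \<pi> i $ \<pi> (p i))"
      using sign_conjugate[OF _ assms] by simp
  qed
  finally show ?thesis by (simp add: det_def)
qed

lemma prod_Basis_vec: "(\<Prod>b\<in>Basis. h b) = (\<Prod>i\<in>UNIV. h (axis i (1::real)))"
proof -
  have "bij_betw (\<lambda>i::'m::finite. axis i (1::real)) UNIV Basis"
    by (auto simp: bij_betw_def inj_on_def axis_eq_axis Basis_vec_def)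
  from prod.reindex_bij_betw[OF this] show ?thesis by metis
qed

lemma borel_measurable_reindex [measurable]: "(\<lambda>y::real^'m. \<chi> i::'k::finite. y $ \<pi> i) \<in> borel_measurable borel"
  by (intro borel_measurable_continuous_onI continuous_intros)

lemma borel_measurable_matrix_vector_mult [measurable]:
  "(\<lambda>y. (A::real^'m^'k) *v y) \<in> borel_measurable borel"
  by (intro borel_measurable_continuous_onI matrix_vector_mult_linear_continuous_on)

lemma lborel_reindex:
  fixes \<pi> :: "'k::finite \<Rightarrow> 'm::finite"
  assumes "bij \<pi>"
  shows "distr lborel borel (\<lambda>y::real^'m. \<chi> i. y $ \<pi> i) = (lborel :: (real^'k) measure)"
proof (rule lborel_eqI[symmetric])
  fix l u :: "real^'k" assume le: "\<And>b. b \<in> Basis \<Longrightarrow> l \<bullet> b \<le> u \<bullet> b"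
  let ?R = "\<lambda>y::real^'m. \<chi> i. y $ \<pi> i"
  let ?l = "\<chi> j. l $ inv \<pi> j" and ?u = "\<chi> j. u $ inv \<pi> j"
  have inv: "inv \<pi> (\<pi> i) = i" "\<pi> (inv \<pi> x) = x" for i x
    using assms by (auto simp: bij_is_inj bij_is_surj surj_f_inv_f)
  have le': "l $ i \<le> u $ i" for i using le[of "axis i 1"] by (simp add: inner_axis)
  have "?R -` box l u = box ?l ?u"
    by (simp add: set_eq_iff mem_box_cart) (metis inv)
  then have "emeasure (distr lborel borel ?R) (box l u) = emeasure lborel (box ?l ?u)"
    by (simp add: emeasure_distr)
  also have "\<dots> = (\<Prod>j\<in>UNIV. u $ inv \<pi> j - l $ inv \<pi> j)"
  proof -
    have "?l \<bullet> b \<le> ?u \<bullet> b" if "b \<in> Basis" for b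
      using that le' by (auto simp: Basis_vec_def inner_axis)
    then show ?thesis by (simp add: emeasure_lborel_box_eq prod_Basis_vec inner_axis)
  qed
  also have "\<dots> = (\<Prod>i\<in>UNIV. u $ i - l $ i)"
    using prod.reindex_bij_betw[OF bij_imp_bij_inv[OF assms], of "\<lambda>i. u $ i - l $ i"] by simp
  finally show "emeasure (distr lborel borel ?R) (box l u) = (\<Prod>b\<in>Basis. (u - l) \<bullet> b)"
    by (simp add: prod_Basis_vec inner_axis)
qed simp

lemma matrix_inv_mult:
  fixes A :: "real^'m^'m"
  assumes "invertible A"
  shows "A ** matrix_inv A = mat 1" "matrix_inv A ** A = mat 1"
  using someI_ex[OF assms[unfolded invertible_def]] unfolding matrix_inv_def by auto

text \<open>
  Lebesgue measure is recovered from its image under an invertible matrix by the factor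
  \<open>\<bar>det S\<bar>\<close>. It suffices to compare the two measures on boxes.
\<close>

lemma lborel_matrix_wellorder:
  fixes S :: "real^('k::{finite,wellorder})^('k::_)"
  assumes "det S \<noteq> 0"
  shows "lborel = density (distr lborel borel ((*v) S)) (\<lambda>_. ennreal \<bar>det S\<bar>)"
proof (rule lborel_eqI)
  fix l u :: "real^'k::_" assume le: "\<And>b. b \<in> Basis \<Longrightarrow> l \<bullet> b \<le> u \<bullet> b"
  have inv: "S ** matrix_inv S = mat 1" "matrix_inv S ** S = mat 1"
    using assms by (simp_all add: invertible_det_nz matrix_inv_mult)
  have pre: "(*v) S -` box l u = (*v) (matrix_inv S) ` box l u"
    by (auto simp: image_iff matrix_vector_mul_assoc inv intro!: bexI[of _ "S *v _"])
  have lin: "linear ((*v) (matrix_inv S))" by (rule matrix_vector_mul_linear)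
  have bor: "(*v) S -` box l u \<in> sets borel"
    by (metis (no_types) borel_measurable_matrix_vector_mult borel_open measurable_sets_borel open_box)
  have "measure lborel ((*v) S -` box l u) = measure lebesgue ((*v) (matrix_inv S) ` box l u)"
    using bor pre by (simp add: measure_completion)
  also have "\<dots> = \<bar>det (matrix_inv S)\<bar> * measure lborel (box l u)"
    by (subst measure_linear_image[OF lin]) (auto simp: measure_completion)
  finally have m: "measure lborel ((*v) S -` box l u) = \<bar>det (matrix_inv S)\<bar> * measure lborel (box l u)" .
  have "(*v) S -` box l u \<in> lmeasurable"
    unfolding pre by (rule measurable_linear_image[OF lin]) simp
  then have fin: "emeasure lborel ((*v) S -` box l u) \<noteq> \<infinity>"
    using bor by (auto simp: fmeasurable_def)
  have dd: "\<bar>det S\<bar> * \<bar>det (matrix_inv S)\<bar> = 1"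
    by (metis abs_mult abs_one det_I det_mul inv(1))
  have "emeasure (density (distr lborel borel ((*v) S)) (\<lambda>_. ennreal \<bar>det S\<bar>)) (box l u)
     = ennreal \<bar>det S\<bar> * emeasure lborel ((*v) S -` box l u)"
    by (simp add: emeasure_density nn_integral_cmult_indicator emeasure_distr)
  also have "\<dots> = ennreal (\<bar>det S\<bar> * measure lborel ((*v) S -` box l u))"
    using fin by (simp add: emeasure_eq_ennreal_measure ennreal_mult top_unique)
  also have "\<dots> = ennreal (measure lborel (box l u))"
    unfolding m using dd by (simp add: mult.assoc[symmetric])
  also have "\<dots> = emeasure lborel (box l u)"
    by (rule emeasure_eq_ennreal_measure[symmetric]) (use emeasure_lborel_box_finite[of l u] in auto)
  finally show "emeasure (density (distr lborel borel ((*v) S)) (\<lambda>_. ennreal \<bar>det S\<bar>)) (box l u)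
     = (\<Prod>b\<in>Basis. (u - l) \<bullet> b)" using le by simp
qed simp

lemma lborel_matrix:
  fixes S :: "real^'m^'m"
  assumes "det S \<noteq> 0"
  shows "lborel = density (distr lborel borel ((*v) S)) (\<lambda>_. ennreal \<bar>det S\<bar>)"
proof -
  obtain \<pi> :: "'m rank_index \<Rightarrow> 'm" where \<pi>: "bij \<pi>" using bij_rank_index by blast
  define S' where "S' = (\<chi> i j. S $ \<pi> i $ \<pi> j)"
  define R where "R = (\<lambda>y::real^'m rank_index. \<chi> i. y $ inv \<pi> i)"
  have R[measurable]: "R \<in> borel_measurable borel" unfolding R_def by measurable
  have d: "det S' = det S" unfolding S'_def by (rule det_reindex[OF \<pi>])
  have L: "lborel = distr lborel borel R"
    unfolding R_def by (rule lborel_reindex[OF bij_imp_bij_inv[OF \<pi>], symmetric])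
  have inv: "inv \<pi> (\<pi> i) = i" "\<pi> (inv \<pi> x) = x" for i x
    using \<pi> by (auto simp: bij_is_inj bij_is_surj surj_f_inv_f)
  have RS: "R (S' *v y) = S *v R y" for y
  proof -
    have "(\<Sum>j\<in>UNIV. S $ i $ \<pi> j * y $ j) = (\<Sum>j\<in>UNIV. S $ i $ j * y $ inv \<pi> j)" for i
      using sum.reindex_bij_betw[OF \<pi>, of "\<lambda>j. S $ i $ j * y $ inv \<pi> j"] by (simp add: inv)
    then show ?thesis
      by (simp add: R_def S'_def matrix_vector_mult_def vec_eq_iff inv)
  qed
  have S'eq: "lborel = density (distr lborel borel ((*v) S')) (\<lambda>_. ennreal \<bar>det S\<bar>)"
    using lborel_matrix_wellorder[of S'] assms d by simp
  show ?thesis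
  proof (rule measure_eqI)
    fix A :: "(real^'m) set" assume "A \<in> sets lborel"
    then have A[measurable]: "A \<in> sets borel" by simp
    have R_emeasure: "emeasure lborel B = emeasure lborel (R -` B)" if "B \<in> sets borel" for B
      by (subst L) (simp add: emeasure_distr that)
    have "emeasure lborel A = emeasure lborel (R -` A)"
      by (rule R_emeasure[OF A])
    also have "\<dots> = emeasure (density (distr lborel borel ((*v) S')) (\<lambda>_. ennreal \<bar>det S\<bar>)) (R -` A)"
      using S'eq by simp
    also have "\<dots> = ennreal \<bar>det S\<bar> * emeasure lborel ((*v) S' -` R -` A)"
      using measurable_sets_borel[OF R A]
      by (simp add: emeasure_density nn_integral_cmult_indicator emeasure_distr)
    also have "(*v) S' -` R -` A = R -` (*v) S -` A"
      by (auto simp: RS)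
    also have "emeasure lborel (R -` (*v) S -` A) = emeasure lborel ((*v) S -` A)"
      using measurable_sets_borel[OF borel_measurable_matrix_vector_mult A, of S]
      by (rule R_emeasure[symmetric])
    also have "ennreal \<bar>det S\<bar> * emeasure lborel ((*v) S -` A)
      = emeasure (density (distr lborel borel ((*v) S)) (\<lambda>_. ennreal \<bar>det S\<bar>)) A"
      by (simp add: emeasure_density nn_integral_cmult_indicator emeasure_distr)
    finally show "emeasure lborel A = emeasure (density (distr lborel borel ((*v) S)) (\<lambda>_. ennreal \<bar>det S\<bar>)) A" .
  qed simp
qed

section \<open>Gaussian integrals\<close>

lemma gaussian_integral_real: "has_bochner_integral lborel (\<lambda>x::real. exp (- (x^2 / 2))) (sqrt (2 * pi))"
proof -
  have "has_bochner_integral lborel (std_normal_density) 1"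
    by (simp add: has_bochner_integral_iff)
  from has_bochner_integral_mult_right[OF this, of "sqrt (2*pi)"] show ?thesis
    by (simp add: std_normal_density_def)
qed

lemma gaussian_integral_std:
  "has_bochner_integral lborel (\<lambda>u::real^'m. exp (- (1/2) * (u \<bullet> u))) (sqrt (2 * pi) ^ CARD('m))"
proof -
  interpret product_sigma_finite "\<lambda>_::real^'m. lborel :: real measure" ..
  let ?T = "\<lambda>f. \<Sum>b\<in>Basis. f b *\<^sub>R (b::real^'m)"
  have eq: "exp (- (1/2) * (?T f \<bullet> ?T f)) = (\<Prod>b\<in>Basis. exp (- (f b ^ 2 / 2)))" for f
  proof -
    have "?T f \<bullet> ?T f = (\<Sum>b\<in>Basis. (f b)^2)"
      by (subst euclidean_inner) (simp add: power2_eq_square)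
    then show ?thesis by (simp add: exp_sum[symmetric] sum_negf sum_divide_distrib)
  qed
  have T[measurable]: "?T \<in> measurable (\<Pi>\<^sub>M b\<in>Basis. lborel) borel" by measurable
  have int: "integrable lborel (\<lambda>x::real. exp (- (x^2 / 2)))"
    "(\<integral>x. exp (- (x^2 / 2)) \<partial>lborel) = sqrt (2 * pi)"
    using gaussian_integral_real by (simp_all add: has_bochner_integral_iff)
  have "has_bochner_integral (\<Pi>\<^sub>M b\<in>(Basis::(real^'m) set). lborel)
     (\<lambda>f. \<Prod>b\<in>Basis. exp (- (f b ^ 2 / 2))) (sqrt (2 * pi) ^ CARD('m))"
    unfolding has_bochner_integral_iff
    by (subst product_integral_prod) (auto simp: int intro!: product_integrable_prod)
  then show ?thesis
    by (subst lborel_eq, intro has_bochner_integral_distr) (simp_all only: eq T, simp)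
qed

text \<open>
  The Gram-Schmidt process for the inner product \<open>v \<bullet> (A *v w)\<close>: the columns of \<open>S\<close> are an
  orthonormal basis for it.
\<close>

lemma posdef_congruent_identity:
  fixes A :: "real^'m^'m"
  assumes sym: "transpose A = A" and pos: "\<And>v. v \<noteq> 0 \<Longrightarrow> v \<bullet> (A *v v) > 0"
  obtains S :: "real^'m^'m" where "transpose S ** A ** S = mat 1"
proof -
  have symA: "v \<bullet> (A *v w) = w \<bullet> (A *v v)" for v w
    by (metis dot_lmul_matrix inner_commute sym vector_transpose_matrix)
  have ex: "\<exists>b::nat \<Rightarrow> real^'m. \<forall>i<k. \<forall>j<k. b i \<bullet> (A *v b j) = (if i = j then 1 else 0)"
    if "k \<le> CARD('m)" for k
    using that
  proof (induction k)
    case 0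
    then show ?case by simp
  next
    case (Suc k)
    then obtain b where b: "\<forall>i<k. \<forall>j<k. b i \<bullet> (A *v b j) = (if i = j then 1 else (0::real))"
      by auto
    \<comment> \<open>Fewer than \<open>CARD('m)\<close> vectors \<open>A *v b j\<close> leave room for a vector orthogonal to all of them.\<close>
    let ?V = "(\<lambda>j. A *v b j) ` {..<k}"
    have "dim (span ?V) \<le> card ?V" by (simp add: dim_le_card')
    also have "card ?V \<le> k" using card_image_le[of "{..<k}"] by simp
    also have "k < DIM(real^'m)" using Suc.prems by simp
    finally obtain x where x: "x \<noteq> 0" "\<And>y. y \<in> span ?V \<Longrightarrow> orthogonal x y"
      using orthogonal_to_subspace_exists[of ?V] by (auto simp: dim_span)
    define c where "c = x \<bullet> (A *v x)"
    have c: "c > 0" using pos x(1) by (simp add: c_def)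
    define b' where "b' = b(k := (1 / sqrt c) *\<^sub>R x)"
    have xb: "x \<bullet> (A *v b j) = 0" if "j < k" for j
      using x(2)[of "A *v b j"] that by (simp add: orthogonal_def span_base)
    have "b' i \<bullet> (A *v b' j) = (if i = j then 1 else 0)" if "i < Suc k" "j < Suc k" for i j
    proof (cases "i = k"; cases "j = k")
      assume "i = k" "j = k"
      then show ?thesis using c by (simp add: b'_def matrix_vector_mult_scaleR c_def[symmetric])
    next
      assume "i = k" "j \<noteq> k"
      then show ?thesis using that xb by (simp add: b'_def)
    next
      assume "i \<noteq> k" "j = k"
      then show ?thesis using that xb symA[of _ x] by (simp add: b'_def matrix_vector_mult_scaleR)
    next
      assume "i \<noteq> k" "j \<noteq> k"
      then show ?thesis using that b by (simp add: b'_def)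
    qed
    then show ?case by blast
  qed
  obtain b :: "nat \<Rightarrow> real^'m" where b: "\<And>i j. i < CARD('m) \<Longrightarrow> j < CARD('m) \<Longrightarrow>
      b i \<bullet> (A *v b j) = (if i = j then 1 else 0)"
    using ex[of "CARD('m)"] by auto
  obtain h :: "'m \<Rightarrow> nat" where h: "bij_betw h UNIV {..<CARD('m)}"
    using ex_bij_betw_finite_nat[of "UNIV::'m set"] by (auto simp: atLeast0LessThan)
  then have hl: "h i < CARD('m)" and hi: "h i = h j \<longleftrightarrow> i = j" for i j
    by (auto simp: bij_betw_def inj_on_def)
  define S :: "real^'m^'m" where "S = (\<chi> i j. b (h j) $ i)"
  have "(transpose S ** A ** S) $ i $ j = mat 1 $ i $ j" for i j
  proof -
    have "(transpose S ** A ** S) $ i $ j = b (h i) \<bullet> (A *v b (h j))"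
      by (simp add: S_def matrix_matrix_mult_def matrix_vector_mult_def transpose_def inner_vec_def
          sum_distrib_left sum_distrib_right mult.assoc) (rule sum.swap)
    also have "\<dots> = mat 1 $ i $ j" using b[OF hl hl] hi by (simp add: mat_def)
    finally show ?thesis .
  qed
  then have "transpose S ** A ** S = mat 1" by (simp add: vec_eq_iff)
  then show ?thesis by (rule that)
qed

lemma gaussian_integral:
  fixes A :: "real^'m^'m"
  assumes sym: "transpose A = A" and pos: "\<And>v. v \<noteq> 0 \<Longrightarrow> v \<bullet> (A *v v) > 0"
  shows "det A > 0"
    and "has_bochner_integral lborel (\<lambda>y. exp (- (1/2) * (y \<bullet> (A *v y))))
      (sqrt ((2 * pi) ^ CARD('m) / det A))"
proof -
  obtain S :: "real^'m^'m" where S: "transpose S ** A ** S = mat 1"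
    using posdef_congruent_identity[OF sym pos] .
  have "det S * det A * det S = 1"
    by (metis S det_I det_mul det_transpose)
  then have dS: "(det S)^2 * det A = 1" by (simp add: power2_eq_square mult_ac)
  then have dS0: "det S \<noteq> 0" by auto
  have dS2: "(det S)^2 = 1 / det A" using dS by (metis mult_cancel_right1 nonzero_eq_divide_eq zero_neq_one mult_zero_right)
  have "0 < (det S)^2" using dS0 by simp
  then show dA: "det A > 0" unfolding dS2 by simp
  have SA: "(S *v u) \<bullet> (A *v (S *v u)) = u \<bullet> u" for u
  proof -
    have "(S *v u) \<bullet> (A *v (S *v u)) = u \<bullet> ((transpose S ** A ** S) *v u)"
      by (simp add: matrix_vector_mul_assoc[symmetric] transpose_matrix_vector inner_commute[of u] dot_lmul_matrix)
        (simp add: inner_commute)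
    then show ?thesis by (simp add: S)
  qed
  have "has_bochner_integral lborel (\<lambda>u. \<bar>det S\<bar> * exp (- (1/2) * ((S *v u) \<bullet> (A *v (S *v u)))))
      (\<bar>det S\<bar> * sqrt (2 * pi) ^ CARD('m))"
    unfolding SA by (intro has_bochner_integral_mult_right gaussian_integral_std)
  then have "has_bochner_integral (density (distr lborel borel ((*v) S)) (\<lambda>_. ennreal \<bar>det S\<bar>))
      (\<lambda>y. exp (- (1/2) * (y \<bullet> (A *v y)))) (\<bar>det S\<bar> * sqrt (2 * pi) ^ CARD('m))"
    unfolding has_bochner_integral_iff
    by (auto simp: integrable_density integral_density integrable_distr_eq integral_distr)
  moreover have "\<bar>det S\<bar> = sqrt (1 / det A)"
    by (metis dS2 real_sqrt_abs)
  then have "\<bar>det S\<bar> * sqrt (2 * pi) ^ CARD('m) = sqrt ((2 * pi) ^ CARD('m) / det A)"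
    by (simp only: real_sqrt_divide real_sqrt_power) simp
  ultimately show "has_bochner_integral lborel (\<lambda>y. exp (- (1/2) * (y \<bullet> (A *v y))))
      (sqrt ((2 * pi) ^ CARD('m) / det A))"
    using lborel_matrix[OF dS0] by simp
qed

section \<open>Second-order calculus with a Lipschitz Hessian\<close>

lemma Dwithin_has_derivative:
  assumes "g differentiable (at x within S)"
  shows "(g has_derivative blinfun_apply (Dwithin S g x)) (at x within S)"
proof -
  have "(g has_derivative frechet_derivative g (at x within S)) (at x within S)"
    using assms by (simp add: frechet_derivative_works)
  then show ?thesis
    unfolding Dwithin_def by (simp add: bounded_linear_Blinfun_apply has_derivative_bounded_linear)
qed

text \<open>
  A second derivative \<open>T\<close> and its matrix of second partial derivatives define the same bilinear form.
\<close>

lemma second_derivative_matrix: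
  fixes T :: "(real^'m) \<Rightarrow>\<^sub>L ((real^'m) \<Rightarrow>\<^sub>L real)"
  shows "v \<bullet> ((\<chi> i j. T (axis i 1) (axis j 1)) *v w) = T v w"
proof -
  have e: "x = (\<Sum>i\<in>UNIV. (x $ i) *\<^sub>R axis i 1)" for x :: "real^'m"
    using basis_expansion[of x] by (simp add: scalar_mult_eq_scaleR)
  have "T v w = T (\<Sum>i\<in>UNIV. (v $ i) *\<^sub>R axis i 1) (\<Sum>i\<in>UNIV. (w $ i) *\<^sub>R axis i 1)"
    using e[of v] e[of w] by simp
  also have "\<dots> = (\<Sum>i\<in>UNIV. \<Sum>j\<in>UNIV. v $ i * (w $ j * T (axis i 1) (axis j 1)))"
    by (simp add: blinfun.sum_right blinfun.sum_left blinfun.scaleR_right blinfun.scaleR_left sum_distrib_left)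
      (subst sum.swap, simp add: mult.left_commute)
  also have "\<dots> = v \<bullet> ((\<chi> i j. T (axis i 1) (axis j 1)) *v w)"
    by (simp add: inner_vec_def matrix_vector_mult_def sum_distrib_left mult_ac)
  finally show ?thesis by simp
qed

lemma transpose_second_derivative_matrix:
  fixes T :: "(real^'m) \<Rightarrow>\<^sub>L ((real^'m) \<Rightarrow>\<^sub>L real)"
  assumes "\<And>v w. T v w = T w v"
  shows "transpose (\<chi> i j. T (axis i 1) (axis j 1)) = (\<chi> i j. T (axis i 1) (axis j 1))"
  using assms by (simp add: transpose_def vec_eq_iff)

lemma nonincreasing_if_derivative_nonpos:
  fixes h :: "real \<Rightarrow> real"
  assumes "\<And>t. t \<in> {0..1} \<Longrightarrow> (h has_real_derivative h' t) (at t within {0..1})"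
    and "\<And>t. t \<in> {0..1} \<Longrightarrow> h' t \<le> 0" and s: "s \<in> {0..1}"
  shows "h s \<le> h 0"
proof -
  have "\<exists>t\<in>{0..s}. h s - h 0 = (\<lambda>u. h' t * u) (s - 0)"
  proof (rule mvt_very_simple)
    fix t assume "0 \<le> t" "t \<le> s"
    then have "(h has_real_derivative h' t) (at t within {0..1})" using s assms(1) by auto
    then show "(h has_derivative (*) (h' t)) (at t within {0..s})"
      unfolding has_field_derivative_def using s by (auto intro: has_derivative_subset)
  qed (use s in auto)
  then obtain t where "t \<in> {0..s}" "h s - h 0 = h' t * s" by auto
  moreover have "h' t * s \<le> 0" using assms(2)[of t] calculation s by (intro mult_nonpos_nonneg) auto
  ultimately show ?thesis by simp
qed

lemma second_order_upper_bound:
  fixes \<phi> :: "real \<Rightarrow> real"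
  assumes d1: "\<And>t. t \<in> {0..1} \<Longrightarrow> (\<phi> has_real_derivative \<phi>' t) (at t within {0..1})"
    and d2: "\<And>t. t \<in> {0..1} \<Longrightarrow> (\<phi>' has_real_derivative \<phi>'' t) (at t within {0..1})"
    and le: "\<And>t. t \<in> {0..1} \<Longrightarrow> \<phi>'' t \<le> c"
  shows "\<phi> 1 \<le> \<phi> 0 + \<phi>' 0 + c / 2"
proof -
  have *: "\<phi>' t \<le> \<phi>' 0 + c * t" if "t \<in> {0..1}" for t
  proof -
    have "\<phi>' t - c * t \<le> \<phi>' 0 - c * 0"
      by (rule nonincreasing_if_derivative_nonpos[where h'="\<lambda>t. \<phi>'' t - c"])
        (use le that in \<open>auto intro!: derivative_eq_intros d2\<close>)
    then show ?thesis by simp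
  qed
  have "\<phi> 1 - \<phi>' 0 * 1 - c * 1^2 / 2 \<le> \<phi> 0 - \<phi>' 0 * 0 - c * 0^2 / 2"
    by (rule nonincreasing_if_derivative_nonpos[where h'="\<lambda>t. \<phi>' t - \<phi>' 0 - c * t"])
      (use * in \<open>auto intro!: derivative_eq_intros d1 simp: algebra_simps\<close>)
  then show ?thesis by simp
qed

lemma second_order_error_bound:
  fixes \<phi> :: "real \<Rightarrow> real"
  assumes d1: "\<And>t. t \<in> {0..1} \<Longrightarrow> (\<phi> has_real_derivative \<phi>' t) (at t within {0..1})"
    and d2: "\<And>t. t \<in> {0..1} \<Longrightarrow> (\<phi>' has_real_derivative \<phi>'' t) (at t within {0..1})"
    and le: "\<And>t. t \<in> {0..1} \<Longrightarrow> \<bar>\<phi>'' t - a\<bar> \<le> k"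
  shows "\<bar>\<phi> 1 - \<phi> 0 - \<phi>' 0 - a / 2\<bar> \<le> k / 2"
proof -
  have "\<phi> 1 \<le> \<phi> 0 + \<phi>' 0 + (a + k) / 2"
    by (rule second_order_upper_bound[OF d1 d2]) (use le in \<open>auto simp: abs_le_iff algebra_simps\<close>)
  moreover have "- \<phi> 1 \<le> - \<phi> 0 + - \<phi>' 0 + (k - a) / 2"
    by (rule second_order_upper_bound[where \<phi>="\<lambda>t. - \<phi> t" and \<phi>'="\<lambda>t. - \<phi>' t" and \<phi>''="\<lambda>t. - \<phi>'' t"])
      (use le in \<open>auto simp: abs_le_iff algebra_simps intro!: derivative_eq_intros d1 d2\<close>)
  ultimately show ?thesis by (simp add: field_simps abs_le_iff)
qed

text \<open>
  On \<open>S\<close>, the function \<open>g\<close> has first derivative \<open>g1\<close> and second derivative \<open>g2\<close>, both taken within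
  \<open>S\<close>, and \<open>g2\<close> is Lipschitz with constant \<open>B\<close> in the operator norm. This is what a bounded third
  derivative provides on a convex set, and all that the argument uses of it. The derivatives are
  parameters, as they are determined by \<open>g\<close> only where \<open>S\<close> is not too thin.
\<close>

definition C2_with_lipschitz_Hessian ::
  "'a::real_normed_vector set \<Rightarrow> real \<Rightarrow> ('a \<Rightarrow> real) \<Rightarrow> ('a \<Rightarrow> 'a \<Rightarrow>\<^sub>L real) \<Rightarrow> ('a \<Rightarrow> 'a \<Rightarrow>\<^sub>L ('a \<Rightarrow>\<^sub>L real)) \<Rightarrow> bool"
  where "C2_with_lipschitz_Hessian S B g g1 g2 \<longleftrightarrow>
    (\<forall>x\<in>S. (g has_derivative blinfun_apply (g1 x)) (at x within S)) \<and>
    (\<forall>x\<in>S. (g1 has_derivative blinfun_apply (g2 x)) (at x within S)) \<and>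
    (\<forall>x\<in>S. \<forall>y\<in>S. norm (g2 x - g2 y) \<le> B * norm (x - y))"

lemma C2_lipschitzD:
  assumes "C2_with_lipschitz_Hessian S B g g1 g2" "x \<in> S" "y \<in> S"
  shows "norm (g2 x - g2 y) \<le> B * norm (x - y)"
  using assms by (simp add: C2_with_lipschitz_Hessian_def)

lemma C2_if_three_times_differentiable:
  assumes "three_times_differentiable_on g S" "convex S"
    and "\<And>x. x \<in> S \<Longrightarrow> norm (Dwithin S (Dwithin S (Dwithin S g)) x) \<le> B"
  shows "C2_with_lipschitz_Hessian S B g (Dwithin S g) (Dwithin S (Dwithin S g))"
proof -
  have "norm (Dwithin S (Dwithin S g) x - Dwithin S (Dwithin S g) y) \<le> B * norm (x - y)"
    if "x \<in> S" "y \<in> S" for x y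
  proof (rule differentiable_bound[OF assms(2) _ _ that])
    show "(Dwithin S (Dwithin S g) has_derivative
      blinfun_apply (Dwithin S (Dwithin S (Dwithin S g)) z)) (at z within S)" if "z \<in> S" for z
      using assms(1) that by (auto simp: three_times_differentiable_on_def differentiable_on_def
          intro!: Dwithin_has_derivative)
    show "onorm (blinfun_apply (Dwithin S (Dwithin S (Dwithin S g)) z)) \<le> B" if "z \<in> S" for z
      using assms(3)[OF that] by (simp add: norm_blinfun.rep_eq)
  qed
  then show ?thesis
    using assms(1) unfolding C2_with_lipschitz_Hessian_def three_times_differentiable_on_def differentiable_on_def
    by (auto intro!: Dwithin_has_derivative)
qed

lemma has_derivative_along_segment:
  assumes "\<And>x. x \<in> S \<Longrightarrow> (F has_derivative F' x) (at x within S)"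
    and "convex S" "x \<in> S" "x + v \<in> S" "t \<in> {0..1}"
  shows "((\<lambda>t. F (x + t *\<^sub>R v)) has_derivative (\<lambda>u. F' (x + t *\<^sub>R v) (u *\<^sub>R v))) (at t within {0..1})"
proof -
  have mem: "x + s *\<^sub>R v \<in> S" if "s \<in> {0..1}" for s
  proof -
    have "(1 - s) *\<^sub>R x + s *\<^sub>R (x + v) \<in> S" using assms that by (intro convexD) auto
    then show ?thesis by (simp add: algebra_simps)
  qed
  show ?thesis
    by (rule has_derivative_in_compose2[where t=S and g=F and f="\<lambda>t. x + t *\<^sub>R v" and g'=F', OF assms(1)])
      (use mem assms(5) in \<open>auto intro!: derivative_eq_intros\<close>)
qed

lemma C2_segment_derivatives:
  assumes C2: "C2_with_lipschitz_Hessian S B g g1 g2" and S: "convex S" "x \<in> S" "x + v \<in> S" and t: "t \<in> {0..1}"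
  shows "((\<lambda>t. g (x + t *\<^sub>R v)) has_real_derivative g1 (x + t *\<^sub>R v) v) (at t within {0..1})"
    and "((\<lambda>t. g1 (x + t *\<^sub>R v) w) has_real_derivative g2 (x + t *\<^sub>R v) v w) (at t within {0..1})"
    and "x + t *\<^sub>R v \<in> S"
proof -
  have "(1 - t) *\<^sub>R x + t *\<^sub>R (x + v) \<in> S" using S t by (intro convexD) auto
  then show "x + t *\<^sub>R v \<in> S" by (simp add: algebra_simps)
  have "((\<lambda>t. g (x + t *\<^sub>R v)) has_derivative (\<lambda>u. g1 (x + t *\<^sub>R v) (u *\<^sub>R v))) (at t within {0..1})"
    by (rule has_derivative_along_segment[OF _ S t]) (use C2 in \<open>auto simp: C2_with_lipschitz_Hessian_def\<close>)
  then show "((\<lambda>t. g (x + t *\<^sub>R v)) has_real_derivative g1 (x + t *\<^sub>R v) v) (at t within {0..1})"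
    by (simp add: has_field_derivative_def blinfun.scaleR_right mult.commute[of _ "blinfun_apply _ _"] mult_commute_abs)
  have "((\<lambda>t. g1 (x + t *\<^sub>R v)) has_derivative (\<lambda>u. g2 (x + t *\<^sub>R v) (u *\<^sub>R v))) (at t within {0..1})"
    by (rule has_derivative_along_segment[OF _ S t]) (use C2 in \<open>auto simp: C2_with_lipschitz_Hessian_def\<close>)
  then have "((\<lambda>t. g1 (x + t *\<^sub>R v) w) has_derivative (\<lambda>u. g2 (x + t *\<^sub>R v) (u *\<^sub>R v) w)) (at t within {0..1})"
    by (rule bounded_linear.has_derivative[OF blinfun.bounded_linear_left])
  then show "((\<lambda>t. g1 (x + t *\<^sub>R v) w) has_real_derivative g2 (x + t *\<^sub>R v) v w) (at t within {0..1})"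
    by (simp add: has_field_derivative_def blinfun.scaleR_right blinfun.scaleR_left mult_commute_abs)
qed

lemma real_mvt_unit_interval:
  fixes h :: "real \<Rightarrow> real"
  assumes "\<And>t. t \<in> {0..1} \<Longrightarrow> (h has_real_derivative h' t) (at t within {0..1})"
  obtains t where "t \<in> {0..1}" "h 1 - h 0 = h' t"
proof -
  have "\<exists>t\<in>{0..1}. h 1 - h 0 = (\<lambda>u. h' t * u) (1 - 0)"
    by (rule mvt_very_simple) (use assms in \<open>auto simp: has_field_derivative_def\<close>)
  then show ?thesis using that by auto
qed

lemma abs_bilinear_le:
  fixes T :: "'a::real_normed_vector \<Rightarrow>\<^sub>L ('a \<Rightarrow>\<^sub>L real)"
  shows "\<bar>T v w\<bar> \<le> norm T * norm v * norm w"
  using norm_blinfun[of "T v" w] mult_right_mono[OF norm_blinfun[of T v], of "norm w"] by simp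

text \<open>
  The mixed second difference is the second derivative up to a term of third order. The difference
  is symmetric in \<open>v\<close> and \<open>w\<close>, so the second derivative is symmetric as well.
\<close>

lemma second_difference:
  assumes C2: "C2_with_lipschitz_Hessian S B g g1 g2" and S: "convex S"
    and mem: "x \<in> S" "x + v \<in> S" "x + w \<in> S" "x + w + v \<in> S" and B: "B \<ge> 0"
  shows "\<bar>g (x + w + v) - g (x + w) - g (x + v) + g x - g2 x w v\<bar> \<le> B * (norm v + norm w) * norm w * norm v"
proof -
  have "((\<lambda>t. g (x + w + t *\<^sub>R v) - g (x + t *\<^sub>R v)) has_real_derivative
     g1 (x + w + t *\<^sub>R v) v - g1 (x + t *\<^sub>R v) v) (at t within {0..1})" if "t \<in> {0..1}" for t
    by (intro derivative_intros C2_segment_derivatives[OF C2 S] mem that)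
  from real_mvt_unit_interval[OF this] obtain t where t: "t \<in> {0..1}"
    "g (x + w + v) - g (x + v) - (g (x + w) - g x) = g1 (x + w + t *\<^sub>R v) v - g1 (x + t *\<^sub>R v) v"
    by (auto simp: add.assoc)
  have mem': "x + t *\<^sub>R v \<in> S" "x + t *\<^sub>R v + w \<in> S"
    using C2_segment_derivatives(3)[OF C2 S mem(1,2) t(1)]
      C2_segment_derivatives(3)[OF C2 S mem(3,4) t(1)] by (auto simp: algebra_simps)
  from real_mvt_unit_interval[OF C2_segment_derivatives(2)[OF C2 S mem', of _ v]]
  obtain s where s: "s \<in> {0..1}"
    "g1 (x + t *\<^sub>R v + 1 *\<^sub>R w) v - g1 (x + t *\<^sub>R v + 0 *\<^sub>R w) v = g2 (x + t *\<^sub>R v + s *\<^sub>R w) w v"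
    by blast
  define z where "z = x + t *\<^sub>R v + s *\<^sub>R w"
  have z: "z \<in> S" unfolding z_def by (rule C2_segment_derivatives(3)[OF C2 S mem' s(1)])
  have eq: "g (x + w + v) - g (x + w) - g (x + v) + g x = g2 z w v"
    using t(2) s(2) by (simp add: z_def algebra_simps)
  have "norm (z - x) \<le> norm (t *\<^sub>R v) + norm (s *\<^sub>R w)"
    unfolding z_def by (metis add.assoc add_diff_cancel_left' norm_triangle_ineq)
  also have "\<dots> \<le> norm v + norm w"
    using t(1) s(1) by (auto intro!: add_mono mult_left_le_one_le)
  finally have zx: "norm (z - x) \<le> norm v + norm w" .
  have "\<bar>g2 z w v - g2 x w v\<bar> = \<bar>(g2 z - g2 x) w v\<bar>"
    by (simp add: blinfun.diff_left)
  also have "\<dots> \<le> norm (g2 z - g2 x) * norm w * norm v" by (rule abs_bilinear_le)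
  also have "\<dots> \<le> (B * norm (z - x)) * norm w * norm v"
    by (intro mult_right_mono C2_lipschitzD[OF C2] z mem) auto
  also have "\<dots> \<le> (B * (norm v + norm w)) * norm w * norm v"
    by (intro mult_right_mono mult_left_mono zx B) auto
  finally show ?thesis by (simp add: eq)
qed

lemma second_derivative_symmetric_interior:
  assumes C2: "C2_with_lipschitz_Hessian S B g g1 g2" and S: "convex S" and x: "x \<in> interior S" and B: "B \<ge> 0"
  shows "g2 x v w = g2 x w v"
proof -
  obtain e where e: "e > 0" "ball x e \<subseteq> S" using x by (meson mem_interior)
  define E where "E = 2 * B * (norm v + norm w) * norm w * norm v"
  define s0 where "s0 = e / (norm v + norm w + 1)"
  have s0: "s0 > 0" using e by (simp add: s0_def add_nonneg_pos)
  have E0: "E \<ge> 0" using B by (simp add: E_def)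
  have key: "\<bar>g2 x v w - g2 x w v\<bar> \<le> s * E" if s: "0 < s" "s < s0" for s
  proof -
    have "0 < norm v + norm w + 1" by (simp add: add_nonneg_pos)
    then have "s * (norm v + norm w + 1) < e"
      using s(2) by (simp add: s0_def pos_less_divide_eq)
    then have sm: "s * norm v + s * norm w + s < e" by (simp add: algebra_simps)
    have nn: "0 \<le> s * norm v" "0 \<le> s * norm w" using s by auto
    have mem: "x \<in> S" "x + s *\<^sub>R v \<in> S" "x + s *\<^sub>R w \<in> S" "x + s *\<^sub>R w + s *\<^sub>R v \<in> S" "x + s *\<^sub>R v + s *\<^sub>R w \<in> S"
    proof -
      have in_ball: "x + u \<in> ball x e" if "norm u < e" for u
        using that by (simp add: dist_norm)
      have nv: "norm (s *\<^sub>R v) = s * norm v" "norm (s *\<^sub>R w) = s * norm w" using s by auto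
      have "norm (s *\<^sub>R v + s *\<^sub>R w) \<le> s * norm v + s * norm w"
        using norm_triangle_ineq[of "s *\<^sub>R v" "s *\<^sub>R w"] unfolding nv .
      then have "norm (s *\<^sub>R v + s *\<^sub>R w) < e" "norm (s *\<^sub>R v) < e" "norm (s *\<^sub>R w) < e"
        unfolding nv using sm nn s by linarith+
      then have "x \<in> ball x e" "x + s *\<^sub>R v \<in> ball x e" "x + s *\<^sub>R w \<in> ball x e"
        "x + (s *\<^sub>R v + s *\<^sub>R w) \<in> ball x e"
        using e in_ball[of "s *\<^sub>R v"] in_ball[of "s *\<^sub>R w"] in_ball[of "s *\<^sub>R v + s *\<^sub>R w"] by simp_all
      then show "x \<in> S" "x + s *\<^sub>R v \<in> S" "x + s *\<^sub>R w \<in> S" "x + s *\<^sub>R w + s *\<^sub>R v \<in> S" "x + s *\<^sub>R v + s *\<^sub>R w \<in> S"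
        using e by (auto simp: add_ac)
    qed
    have "s\<^sup>2 * \<bar>g2 x v w - g2 x w v\<bar> = \<bar>g2 x (s *\<^sub>R v) (s *\<^sub>R w) - g2 x (s *\<^sub>R w) (s *\<^sub>R v)\<bar>"
      by (simp add: blinfun.scaleR_left blinfun.scaleR_right power2_eq_square abs_mult flip: right_diff_distrib)
    also have "\<dots> \<le> B * (norm (s *\<^sub>R v) + norm (s *\<^sub>R w)) * norm (s *\<^sub>R w) * norm (s *\<^sub>R v) +
         B * (norm (s *\<^sub>R w) + norm (s *\<^sub>R v)) * norm (s *\<^sub>R v) * norm (s *\<^sub>R w)"
      using second_difference[OF C2 S mem(1,2,3,4) B] second_difference[OF C2 S mem(1,3,2,5) B]
      unfolding add.assoc add.commute[of "s *\<^sub>R v" "s *\<^sub>R w"] by linarith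
    also have "\<dots> = s\<^sup>2 * (s * E)"
      using s by (simp add: E_def power2_eq_square algebra_simps)
    finally show ?thesis using s by simp
  qed
  have "\<bar>g2 x v w - g2 x w v\<bar> \<le> 0"
  proof (rule field_le_epsilon)
    fix \<eta> :: real assume \<eta>: "\<eta> > 0"
    define s where "s = min (s0/2) (\<eta> / (E + 1))"
    have "s > 0" using s0 \<eta> E0 by (simp add: s_def)
    moreover have "s \<le> s0 / 2" unfolding s_def by (rule min.cobounded1)
    ultimately have s: "0 < s" "s < s0" using s0 by linarith+
    have "s * E \<le> \<eta> / (E+1) * (E + 1)"
      using E0 s \<eta> by (intro mult_mono) (auto simp: s_def)
    then show "\<bar>g2 x v w - g2 x w v\<bar> \<le> 0 + \<eta>" using key[OF s] E0 by simp
  qed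
  then show ?thesis by simp
qed

text \<open>
  Boundary points are limits of interior points, and \<open>g2\<close> is continuous.
\<close>

lemma second_derivative_symmetric:
  fixes g :: "'a::euclidean_space \<Rightarrow> real"
  assumes C2: "C2_with_lipschitz_Hessian S B g g1 g2" and S: "convex S" "interior S \<noteq> {}" and x: "x \<in> S" and B: "B \<ge> 0"
  shows "g2 x v w = g2 x w v"
proof -
  have "x \<in> closure (interior S)"
    using x convex_closure_interior[OF S] closure_subset by blast
  then obtain y where y: "\<And>n. y n \<in> interior S" "y \<longlonglongrightarrow> x"
    unfolding closure_sequential by blast
  have le: "\<bar>g2 x v w - g2 x w v\<bar> \<le> 2 * B * norm (x - y n) * norm v * norm w" for n
  proof -
    have yS: "y n \<in> S" using y(1) interior_subset by blast
    have "\<bar>(g2 x - g2 (y n)) v w\<bar> \<le> (B * norm (x - y n)) * norm v * norm w" for v w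
      by (rule order_trans[OF abs_bilinear_le]) (intro mult_right_mono C2_lipschitzD[OF C2] x yS norm_ge_zero)
    from this[of v w] this[of w v] show ?thesis
      using second_derivative_symmetric_interior[OF C2 S(1) y(1) B, of n v w]
      by (simp add: blinfun.diff_left abs_le_iff algebra_simps)
  qed
  have "(\<lambda>n. 2 * B * norm (x - y n) * norm v * norm w) \<longlonglongrightarrow> 2 * B * norm (x - x) * norm v * norm w"
    by (intro tendsto_intros y)
  then have "\<bar>g2 x v w - g2 x w v\<bar> \<le> 2 * B * norm (x - x) * norm v * norm w"
    by (rule LIMSEQ_le_const) (use le in auto)
  then show ?thesis by simp
qed

lemma second_derivative_nonpos_at_max:
  assumes C2: "C2_with_lipschitz_Hessian S B g g1 g2" and S: "convex S" and p: "p \<in> interior S" and B: "B \<ge> 0"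
    and max: "\<And>x. x \<in> S \<Longrightarrow> g x \<le> g p"
  shows "g1 p = 0" and "g2 p v v \<le> 0"
proof -
  have pS: "p \<in> S" using p interior_subset by blast
  have "(g has_derivative blinfun_apply (g1 p)) (at p)"
    using C2 pS p unfolding C2_with_lipschitz_Hessian_def by (metis at_within_interior)
  then have "blinfun_apply (g1 p) = (\<lambda>v. 0)"
    by (rule differential_zero_maxmin[OF p open_interior]) (use max interior_subset in blast)
  then show g1: "g1 p = 0" by (intro blinfun_eqI) simp
  show "g2 p v v \<le> 0"
  proof (rule ccontr)
    assume neg: "\<not> g2 p v v \<le> 0"
    define c where "c = g2 p v v"
    have c: "c > 0" using neg by (simp add: c_def)
    obtain e where e: "e > 0" "ball p e \<subseteq> S" using p by (meson mem_interior)
    define E where "E = B * norm v ^ 3"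
    have E: "E \<ge> 0" using B by (simp add: E_def)
    \<comment> \<open>The step \<open>s\<close> keeps \<open>p + s *\<^sub>R v\<close> in the ball and makes the third-order error \<open>s ^ 3 * E / 2\<close>
      smaller than the second-order gain \<open>s\<^sup>2 * c / 2\<close>.\<close>
    define s where "s = min (e / (2 * (norm v + 1))) (c / (2 * (E + 1)))"
    have s: "s > 0" using e c E by (simp add: s_def add_nonneg_pos)
    have "s * norm v \<le> e / (2 * (norm v + 1)) * (norm v + 1)"
      using s e by (intro mult_mono) (auto simp: s_def)
    also have "\<dots> = e / 2" using add_nonneg_pos[OF norm_ge_zero[of v] zero_less_one] by (simp add: field_simps)
    also have "\<dots> < e" using e by simp
    finally have sv: "s * norm v < e" .
    have mem: "p + s *\<^sub>R v \<in> S"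
      using e(2) sv s by (auto simp: dist_norm intro!: subsetD[OF e(2)])
    have "\<bar>g (p + 1 *\<^sub>R (s *\<^sub>R v)) - g (p + 0 *\<^sub>R (s *\<^sub>R v)) - g1 (p + 0 *\<^sub>R (s *\<^sub>R v)) (s *\<^sub>R v) - g2 p (s *\<^sub>R v) (s *\<^sub>R v) / 2\<bar> \<le> (s^3 * E) / 2"
    proof (rule second_order_error_bound[OF C2_segment_derivatives(1,2)[OF C2 S pS mem]])
      fix t :: real assume t: "t \<in> {0..1}"
      let ?z = "p + t *\<^sub>R (s *\<^sub>R v)"
      have z: "?z \<in> S" by (rule C2_segment_derivatives(3)[OF C2 S pS mem t])
      have "\<bar>g2 ?z (s *\<^sub>R v) (s *\<^sub>R v) - g2 p (s *\<^sub>R v) (s *\<^sub>R v)\<bar> = \<bar>(g2 ?z - g2 p) (s *\<^sub>R v) (s *\<^sub>R v)\<bar>"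
        by (simp add: blinfun.diff_left)
      also have "\<dots> \<le> norm (g2 ?z - g2 p) * norm (s *\<^sub>R v) * norm (s *\<^sub>R v)"
        by (rule abs_bilinear_le)
      also have "\<dots> \<le> (B * norm (?z - p)) * norm (s *\<^sub>R v) * norm (s *\<^sub>R v)"
        by (intro mult_right_mono C2_lipschitzD[OF C2] z pS norm_ge_zero)
      also have "\<dots> \<le> (B * norm (s *\<^sub>R v)) * norm (s *\<^sub>R v) * norm (s *\<^sub>R v)"
        using t s by (intro mult_right_mono mult_left_mono B norm_ge_zero) (auto intro: mult_left_le_one_le)
      also have "\<dots> = s^3 * E" using s by (simp add: E_def power3_eq_cube)
      finally show "\<bar>g2 ?z (s *\<^sub>R v) (s *\<^sub>R v) - g2 p (s *\<^sub>R v) (s *\<^sub>R v)\<bar> \<le> s^3 * E" .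
    qed
    then have "\<bar>g (p + s *\<^sub>R v) - g p - s\<^sup>2 * c / 2\<bar> \<le> s^3 * E / 2"
      by (simp add: g1 blinfun.scaleR_left blinfun.scaleR_right c_def power2_eq_square mult.assoc)
    then have "g (p + s *\<^sub>R v) - g p \<ge> s^2 * c / 2 - s^3 * E / 2"
      by linarith
    moreover have "s * E < c"
    proof -
      have "s * E \<le> c / (2 * (E + 1)) * (E + 1)"
        using s E c by (intro mult_mono) (auto simp: s_def)
      also have "\<dots> = c / 2" using E by (simp add: field_simps)
      also have "\<dots> < c" using c by simp
      finally show ?thesis .
    qed
    then have "s^2 * (c - s * E) > 0" using s by simp
    ultimately have "g (p + s *\<^sub>R v) > g p"
      by (simp add: power2_eq_square power3_eq_cube algebra_simps)
    then show False using max[OF mem] by simp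
  qed
qed

text \<open>
  If semidefiniteness always improves to definiteness with the margin \<open>lam\<close>, then definiteness at one
  point of a convex set spreads to all points: along a segment divided so finely that \<open>g2\<close> changes by
  at most \<open>lam\<close> in each step, it cannot be lost.
\<close>

lemma negative_definite_propagates:
  assumes C2: "C2_with_lipschitz_Hessian S B g g1 g2" and S: "convex S" and lam: "lam > 0"
    and gap: "\<And>x. x \<in> S \<Longrightarrow> (\<And>v. g2 x v v \<le> 0) \<Longrightarrow> (\<And>v. g2 x v v \<le> - lam * (norm v)\<^sup>2)"
    and p: "p \<in> S" "\<And>v. g2 p v v \<le> 0" and x: "x \<in> S"
  shows "g2 x v v \<le> - lam * (norm v)\<^sup>2"
proof -
  obtain n :: nat where n: "n > B * norm (x - p) / lam" "n > 0"
    by (metis reals_Archimedean2 gr_zeroI less_trans linorder_not_less of_nat_0 of_nat_0_less_iff)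
  define q where "q k = p + (real k / n) *\<^sub>R (x - p)" for k
  have qS: "q k \<in> S" if "k \<le> n" for k
  proof -
    have "p + (real k / n) *\<^sub>R (x - p) = (1 - real k / n) *\<^sub>R p + (real k / n) *\<^sub>R x"
      by (simp add: algebra_simps)
    then show ?thesis unfolding q_def using that n p(1) x by (auto intro!: convexD[OF S])
  qed
  have step: "norm (g2 (q (Suc k)) - g2 (q k)) \<le> lam" if "Suc k \<le> n" for k
  proof -
    have "norm (g2 (q (Suc k)) - g2 (q k)) \<le> B * norm (q (Suc k) - q k)"
      using that by (intro C2_lipschitzD[OF C2] qS) auto
    also have "q (Suc k) - q k = (1 / n) *\<^sub>R (x - p)"
      by (simp add: q_def add_divide_distrib algebra_simps)
    also have "B * norm ((1 / n) *\<^sub>R (x - p)) = B * norm (x - p) / n" by simp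
    also have "\<dots> \<le> lam" using n lam by (simp add: field_simps)
    finally show ?thesis .
  qed
  have "\<forall>v. g2 (q k) v v \<le> 0" if "k \<le> n" for k
    using that
  proof (induction k)
    case 0
    then show ?case using p by (simp add: q_def)
  next
    case (Suc k)
    then have IH: "g2 (q k) v v \<le> - lam * (norm v)\<^sup>2" for v
      by (intro gap qS) auto
    show ?case
    proof
      fix v
      have "\<bar>(g2 (q (Suc k)) - g2 (q k)) v v\<bar> \<le> lam * norm v * norm v"
        by (rule order_trans[OF abs_bilinear_le]) (intro mult_right_mono step Suc.prems norm_ge_zero)
      then show "g2 (q (Suc k)) v v \<le> 0"
        using IH[of v] by (simp add: blinfun.diff_left power2_eq_square mult.assoc abs_le_iff)
    qed
  qed
  from this[of n] have "\<And>v. g2 x v v \<le> 0" using n by (simp add: q_def)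
  from gap[OF x this] show ?thesis .
qed

text \<open>
  A function with second derivative at most \<open>- lam\<close> decays quadratically from its critical point,
  and its gradient grows at least linearly with the distance from that point.
\<close>

lemma strongly_concave_max:
  assumes C2: "C2_with_lipschitz_Hessian S B g g1 g2" and S: "convex S"
    and nd: "\<And>x v. x \<in> S \<Longrightarrow> g2 x v v \<le> - lam * (norm v)\<^sup>2"
    and p: "p \<in> S" "g1 p = 0" and x: "x \<in> S"
  shows "g x \<le> g p - lam / 2 * (norm (x - p))\<^sup>2" and "lam * norm (x - p) \<le> norm (g1 x)"
proof -
  define v where "v = x - p"
  have mem: "p + v \<in> S" using x by (simp add: v_def)
  note d = C2_segment_derivatives[OF C2 S p(1) mem]
  have "g (p + 1 *\<^sub>R v) \<le> g (p + 0 *\<^sub>R v) + g1 (p + 0 *\<^sub>R v) v + (- lam * (norm v)\<^sup>2) / 2"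
    by (rule second_order_upper_bound[OF d(1,2)]) (assumption | rule nd d(3))+
  then show "g x \<le> g p - lam / 2 * (norm (x - p))\<^sup>2"
    using p by (simp add: v_def)
  obtain t where t: "t \<in> {0..1}" "g1 (p + 1 *\<^sub>R v) v - g1 (p + 0 *\<^sub>R v) v = g2 (p + t *\<^sub>R v) v v"
    using real_mvt_unit_interval[OF d(2)] by blast
  have "g1 x v \<le> - lam * (norm v)\<^sup>2"
    using t nd[OF d(3)[OF t(1)], of v] p by (simp add: v_def)
  then have "lam * norm v * norm v \<le> \<bar>g1 x v\<bar>"
    by (simp add: power2_eq_square mult.assoc abs_if)
  also have "\<dots> \<le> norm (g1 x) * norm v" using norm_blinfun[of "g1 x" v] by simp
  finally show "lam * norm (x - p) \<le> norm (g1 x)"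
    using norm_ge_zero[of "g1 x"] by (cases "v = 0") (auto simp: v_def mult_le_cancel_right)
qed

section \<open>Uniform definiteness from a determinant bound\<close>

lemma kernel_of_semidefinite:
  fixes A :: "real^'m^'m"
  assumes sym: "transpose A = A" and nonpos: "\<And>v. v \<bullet> (A *v v) \<le> 0" and z: "u \<bullet> (A *v u) = 0"
  shows "A *v u = 0"
proof (rule ccontr)
  define w where "w = A *v u"
  define q where "q = w \<bullet> (A *v w)"
  assume "A *v u \<noteq> 0"
  then have w: "w \<bullet> w > 0" by (simp add: w_def)
  have q: "q \<le> 0" using nonpos by (simp add: q_def)
  \<comment> \<open>Moving from \<open>u\<close> in the direction \<open>w\<close> increases the form from \<open>0\<close> at first order, against its sign.
    This value of \<open>t\<close> makes the second-order term smaller than the first-order one.\<close>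
  define t where "t = (w \<bullet> w) / (1 - q)"
  have t: "t > 0" using w q by (simp add: t_def)
  have uw: "u \<bullet> (A *v w) = w \<bullet> w"
    by (metis dot_lmul_matrix inner_commute sym vector_transpose_matrix w_def)
  have "(u + t *\<^sub>R w) \<bullet> (A *v (u + t *\<^sub>R w)) = t * (2 * (w \<bullet> w) + t * q)"
    by (simp add: matrix_vector_right_distrib matrix_vector_mult_scaleR inner_add_left inner_add_right z z[folded w_def] uw q_def
        flip: w_def) (simp add: algebra_simps)
  moreover have "t * (1 - q) = w \<bullet> w" using q by (simp add: t_def)
  then have "t * q = t - w \<bullet> w" by (simp add: algebra_simps)
  then have "2 * (w \<bullet> w) + t * q > 0" using w t by linarith
  ultimately show False using nonpos[of "u + t *\<^sub>R w"] t
    by (metis mult_pos_pos not_le)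
qed

text \<open>
  The matrices in question form a compact set, so the quadratic form attains its supremum over that set
  and the unit sphere. A supremum \<open>0\<close> would be attained at a kernel vector, contradicting the bound on
  the determinant.
\<close>

lemma uniform_negative_definiteness:
  fixes B d :: real
  assumes d: "d > 0"
  obtains lam where "lam > 0"
    "\<And>(A::real^'m^'m) v. transpose A = A \<Longrightarrow> (\<And>i j. \<bar>A $ i $ j\<bar> \<le> B) \<Longrightarrow> \<bar>det A\<bar> \<ge> d \<Longrightarrow>
      (\<And>v. v \<bullet> (A *v v) \<le> 0) \<Longrightarrow> v \<bullet> (A *v v) \<le> - lam * (norm v)\<^sup>2"
proof -
  \<comment> \<open>The hypotheses are written out in the entries of \<open>A\<close>, which makes closedness of \<open>K\<close> immediate.\<close>
  define K :: "(real^'m^'m) set" where "K = {A. (\<forall>i j. A $ i $ j = A $ j $ i) \<and> (\<forall>i j. \<bar>A $ i $ j\<bar> \<le> B) \<and> \<bar>det A\<bar> \<ge> d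
      \<and> (\<forall>v. (\<Sum>i\<in>UNIV. \<Sum>j\<in>UNIV. v $ i * A $ i $ j * v $ j) \<le> 0)}"
  have quad: "v \<bullet> (A *v v) = (\<Sum>i\<in>UNIV. \<Sum>j\<in>UNIV. v $ i * A $ i $ j * v $ j)" for A :: "real^'m^'m" and v
    by (simp add: inner_vec_def matrix_vector_mult_def sum_distrib_left mult.assoc)
  have contdet: "continuous_on UNIV (det :: real^'m^'m \<Rightarrow> real)"
    unfolding det_def by (intro continuous_intros)
  have "closed K"
    unfolding K_def
    by (intro closed_Collect_conj closed_Collect_all closed_Collect_eq closed_Collect_le continuous_intros contdet)
  moreover have "bounded K"
  proof (rule boundedI)
    fix A assume A: "A \<in> K"
    have "norm A \<le> (\<Sum>i\<in>UNIV. norm (A $ i))"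
      unfolding norm_vec_def by (rule L2_set_le_sum) simp
    also have "\<dots> \<le> (\<Sum>i\<in>(UNIV::'m set). \<Sum>j\<in>(UNIV::'m set). B)"
      using A by (intro sum_mono order_trans[OF norm_le_l1_cart]) (auto simp: K_def)
    finally show "norm A \<le> (\<Sum>i\<in>(UNIV::'m set). \<Sum>j\<in>(UNIV::'m set). B)" .
  qed
  ultimately have "compact K" by (simp add: compact_eq_bounded_closed)
  then have cpt: "compact (K \<times> sphere (0::real^'m) 1)" by (intro compact_Times) auto
  have trK: "transpose A = A" if "A \<in> K" for A
    using that by (simp add: K_def transpose_def vec_eq_iff)
  have inK: "A \<in> K" if "transpose A = A" "\<And>i j. \<bar>A $ i $ j\<bar> \<le> B" "\<bar>det A\<bar> \<ge> d" "\<And>v. v \<bullet> (A *v v) \<le> 0" for A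
  proof -
    have "A $ i $ j = A $ j $ i" for i j
      using that(1) by (metis transpose_def vec_lambda_beta)
    then show ?thesis using that unfolding K_def quad by blast
  qed
  have ex: "\<exists>lam>0. \<forall>A\<in>K. \<forall>u\<in>sphere 0 1. u \<bullet> (A *v u) \<le> - lam"
  proof (cases "K = {}")
    case True
    then show ?thesis by (auto intro: exI[of _ 1])
  next
    case False
    let ?F = "\<lambda>p::(real^'m^'m) \<times> (real^'m). snd p \<bullet> (fst p *v snd p)"
    have "(axis undefined 1 :: real^'m) \<in> sphere 0 1" by simp
    then have ne: "K \<times> sphere (0::real^'m) 1 \<noteq> {}" using False by blast
    have "continuous_on (K \<times> sphere 0 1) ?F"
      unfolding quad by (intro continuous_intros)
    from continuous_attains_sup[OF cpt ne this] obtain A u where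
      Au: "A \<in> K" "u \<in> sphere 0 1" and max: "\<And>A' u'. A' \<in> K \<Longrightarrow> u' \<in> sphere 0 1 \<Longrightarrow> u' \<bullet> (A' *v u') \<le> u \<bullet> (A *v u)"
      by fastforce
    have npA: "\<And>v. v \<bullet> (A *v v) \<le> 0" using Au(1) unfolding K_def quad by blast
    have "u \<bullet> (A *v u) \<noteq> 0"
    proof
      assume "u \<bullet> (A *v u) = 0"
      then have "A *v u = 0" using kernel_of_semidefinite[OF trK[OF Au(1)] npA] by blast
      moreover have "u \<noteq> 0" using Au(2) by auto
      ultimately have "\<not> invertible A"
        by (metis invertible_def matrix_vector_mul_assoc matrix_vector_mul_lid matrix_vector_mult_0_right)
      then have "det A = 0" by (simp add: invertible_det_nz)
      then show False using Au(1) d by (simp add: K_def)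
    qed
    then show ?thesis using npA[of u] max by (intro exI[of _ "- (u \<bullet> (A *v u))"]) auto
  qed
  then obtain lam where lam: "lam > 0" "\<And>A u. A \<in> K \<Longrightarrow> u \<in> sphere 0 1 \<Longrightarrow> u \<bullet> (A *v u) \<le> - lam" by blast
  show ?thesis
  proof (rule that[OF lam(1)])
    fix A :: "real^'m^'m" and v :: "real^'m"
    assume "transpose A = A" "\<And>i j. \<bar>A $ i $ j\<bar> \<le> B" "\<bar>det A\<bar> \<ge> d" "\<And>v. v \<bullet> (A *v v) \<le> 0"
    then have A: "A \<in> K" by (rule inK)
    show "v \<bullet> (A *v v) \<le> - lam * (norm v)\<^sup>2"
    proof (cases "v = 0")
      case False
      define u where "u = v /\<^sub>R norm v"
      have v: "v = norm v *\<^sub>R u" using False by (simp add: u_def)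
      have "u \<bullet> (A *v u) \<le> - lam" using lam(2)[OF A, of u] False by (simp add: u_def)
      then have "(norm v)\<^sup>2 * (u \<bullet> (A *v u)) \<le> (norm v)\<^sup>2 * - lam" by (intro mult_left_mono) auto
      moreover have "v \<bullet> (A *v v) = (norm v)\<^sup>2 * (u \<bullet> (A *v u))"
        by (subst (1 2) v) (simp only: matrix_vector_mult_scaleR inner_scaleR_left inner_scaleR_right power2_eq_square mult.assoc)
      ultimately show ?thesis by (simp add: mult.commute)
    qed simp
  qed
qed

section \<open>Perturbation of Gaussian integrals\<close>

lemma integrable_gaussian_weight:
  assumes k: "k > 0"
  shows "integrable lborel (\<lambda>y::real^'m. exp (a * norm y) * ((1 + norm y ^ 3) * exp (- k * (norm y)\<^sup>2)))"
proof -
  let ?A = "k *\<^sub>R (mat 1 :: real^'m^'m)"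
  have A: "?A *v y = k *\<^sub>R y" for y
    by (simp add: scaleR_matrix_vector_assoc[symmetric])
  have "transpose ?A = ?A"
    by (simp add: transpose_def mat_def vec_eq_iff)
  then have "integrable lborel (\<lambda>y::real^'m. exp (- (1/2) * (y \<bullet> (?A *v y))))"
    using gaussian_integral(2)[of ?A] k by (auto simp: A has_bochner_integral_iff)
  then have int: "integrable lborel (\<lambda>y::real^'m. exp (- (1/2) * (y \<bullet> (?A *v y))) * (27 * exp ((a+1)\<^sup>2 / (2 * k))))"
    by (rule integrable_mult_left)
  show ?thesis
  proof (rule Bochner_Integration.integrable_bound[OF int], measurable, rule AE_I2)
    fix y :: "real^'m"
    define s where "s = norm y"
    have s: "s \<ge> 0" by (simp add: s_def)
    have "1 + s ^ 3 \<le> 27 * exp s"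
    proof -
      have "27 * (1 + s / 3) ^ 3 = 27 + 27 * s + 9 * s\<^sup>2 + s ^ 3"
        by (simp add: power3_eq_cube power2_eq_square field_simps)
      then have "1 + s ^ 3 \<le> 27 * (1 + s / 3) ^ 3" using s by simp
      also have "(1 + s / 3) ^ 3 \<le> exp s"
        using exp_ge_one_plus_x_over_n_power_n[of 3 s] s by simp
      finally show ?thesis by simp
    qed
    show "norm (exp (a * norm y) * ((1 + norm y ^ 3) * exp (- k * (norm y)\<^sup>2))) \<le>
      norm (exp (- (1/2) * (y \<bullet> (?A *v y))) * (27 * exp ((a+1)\<^sup>2 / (2 * k))))"
    proof -
      have "(a + 1) * s - k * s\<^sup>2 \<le> - (1/2) * (k * s\<^sup>2) + (a+1)\<^sup>2 / (2 * k)"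
      proof -
        have "0 \<le> (k * s - (a + 1))\<^sup>2 / (2 * k)" using k by simp
        also have "\<dots> = k * s\<^sup>2 / 2 - (a + 1) * s + (a+1)\<^sup>2 / (2 * k)"
          using k by (simp add: power2_eq_square field_simps)
        finally show ?thesis by simp
      qed
      then have e: "exp (a * s) * exp s * exp (- k * s\<^sup>2) \<le> exp (- (1/2) * (k * s\<^sup>2)) * exp ((a+1)\<^sup>2 / (2 * k))"
        by (simp add: exp_add[symmetric] algebra_simps)
      have "exp (a * s) * ((1 + s ^ 3) * exp (- k * s\<^sup>2)) \<le> exp (a * s) * ((27 * exp s) * exp (- k * s\<^sup>2))"
        by (intro mult_left_mono mult_right_mono) (use \<open>1 + s ^ 3 \<le> 27 * exp s\<close> in auto)
      also have "\<dots> \<le> exp (- (1/2) * (k * s\<^sup>2)) * (27 * exp ((a+1)\<^sup>2 / (2 * k)))"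
        using e by (simp add: mult_ac)
      finally show ?thesis
        using s by (simp add: A s_def dot_square_norm)
    qed
  qed
qed

text \<open>
  The weight \<open>h\<close> may grow exponentially. The error constant depends on \<open>h\<close> only through its growth
  bounds \<open>c\<close> and \<open>a\<close>, so that the estimate applies to weights varying with \<open>N\<close>.
\<close>

lemma weighted_gaussian_perturbation:
  fixes h q \<gamma> :: "real^'m \<Rightarrow> real"
  assumes k: "k > 0" and a: "a \<ge> 0"
    and q[measurable]: "q \<in> borel_measurable lebesgue"
    and h[measurable]: "h \<in> borel_measurable borel" and g[measurable]: "\<gamma> \<in> borel_measurable borel"
    and close: "\<And>y. \<bar>q y - \<gamma> y\<bar> \<le> \<delta> * ((1 + norm y ^ 3) * exp (- k * (norm y)\<^sup>2))"
    and gb: "\<And>y. \<bar>\<gamma> y\<bar> \<le> exp (- k * (norm y)\<^sup>2)"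
    and hb: "\<And>y. \<bar>h y\<bar> \<le> c * exp (a * norm y)" and c: "c \<ge> 0"
  shows "integrable lborel (\<lambda>y. h y * \<gamma> y)"
    and "\<bar>\<integral>y. h y * \<gamma> y \<partial>lborel\<bar>
      \<le> c * (\<integral>y. exp (a * norm y) * ((1 + norm y ^ 3) * exp (- k * (norm y)\<^sup>2)) \<partial>(lborel :: (real^'m) measure))"
    and "integrable lebesgue (\<lambda>y. h y * q y)"
    and "\<bar>(\<integral>y. h y * q y \<partial>lebesgue) - (\<integral>y. h y * \<gamma> y \<partial>lborel)\<bar>
      \<le> c * \<delta> * (\<integral>y. exp (a * norm y) * ((1 + norm y ^ 3) * exp (- k * (norm y)\<^sup>2)) \<partial>(lborel :: (real^'m) measure))"
proof -
  define W where "W = (\<lambda>y::real^'m. exp (a * norm y) * ((1 + norm y ^ 3) * exp (- k * (norm y)\<^sup>2)))"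
  have W[measurable]: "W \<in> borel_measurable borel" unfolding W_def by measurable
  have intW: "integrable lborel W" unfolding W_def by (rule integrable_gaussian_weight[OF k])
  have intWl: "integrable lebesgue W" using intW by (simp add: integrable_completion)
  have hl[measurable]: "h \<in> borel_measurable lebesgue" "\<gamma> \<in> borel_measurable lebesgue" "W \<in> borel_measurable lebesgue"
    by (simp_all add: measurable_completion)
  have hg: "\<bar>h y * \<gamma> y\<bar> \<le> c * W y" for y
  proof -
    have "\<bar>h y * \<gamma> y\<bar> \<le> (c * exp (a * norm y)) * ((1 + norm y ^ 3) * exp (- k * (norm y)\<^sup>2))"
      unfolding abs_mult
    proof (intro mult_mono hb)
      have "exp (- k * (norm y)\<^sup>2) \<le> (1 + norm y ^ 3) * exp (- k * (norm y)\<^sup>2)" by simp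
      then show "\<bar>\<gamma> y\<bar> \<le> (1 + norm y ^ 3) * exp (- k * (norm y)\<^sup>2)" using gb[of y] by linarith
    qed (use c in auto)
    then show ?thesis by (simp add: W_def mult.assoc)
  qed
  show hg_int: "integrable lborel (\<lambda>y. h y * \<gamma> y)"
    by (rule Bochner_Integration.integrable_bound[OF integrable_mult_right[OF intW, of c]])
      (use hg in \<open>auto intro!: AE_I2 order_trans[OF hg]\<close>)
  have "\<bar>\<integral>y. h y * \<gamma> y \<partial>lborel\<bar> \<le> (\<integral>y. c * W y \<partial>lborel)"
    by (rule order_trans[OF integral_abs_bound]) (intro integral_mono hg integrable_abs hg_int integrable_mult_right intW)
  then show "\<bar>\<integral>y. h y * \<gamma> y \<partial>lborel\<bar>
      \<le> c * (\<integral>y. exp (a * norm y) * ((1 + norm y ^ 3) * exp (- k * (norm y)\<^sup>2)) \<partial>(lborel :: (real^'m) measure))"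
    by (simp add: W_def)
  have hd: "\<bar>h y * (q y - \<gamma> y)\<bar> \<le> c * \<delta> * W y" for y
  proof -
    have "\<bar>h y * (q y - \<gamma> y)\<bar> \<le> (c * exp (a * norm y)) * (\<delta> * ((1 + norm y ^ 3) * exp (- k * (norm y)\<^sup>2)))"
      unfolding abs_mult by (intro mult_mono hb close) (use c in auto)
    then show ?thesis by (simp add: W_def mult_ac)
  qed
  have hd_int: "integrable lebesgue (\<lambda>y. h y * (q y - \<gamma> y))"
    by (rule Bochner_Integration.integrable_bound[OF integrable_mult_right[OF intWl, of "c * \<delta>"]])
      (use hd in \<open>auto intro!: AE_I2 order_trans[OF hd]\<close>)
  have hgi: "integrable lebesgue (\<lambda>y. h y * \<gamma> y)" using hg_int by (simp add: integrable_completion)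
  from Bochner_Integration.integrable_add[OF hd_int hgi] show hq_int: "integrable lebesgue (\<lambda>y. h y * q y)"
    by (simp add: algebra_simps)
  have "(\<integral>y. h y * q y \<partial>lebesgue) - (\<integral>y. h y * \<gamma> y \<partial>lborel) = (\<integral>y. h y * (q y - \<gamma> y) \<partial>lebesgue)"
    using hgi hq_int by (simp add: integral_completion right_diff_distrib)
  also have "\<bar>\<dots>\<bar> \<le> (\<integral>y. c * \<delta> * W y \<partial>lebesgue)"
    by (rule order_trans[OF integral_abs_bound]) (intro integral_mono hd integrable_abs hd_int integrable_mult_right intWl)
  also have "\<dots> = c * \<delta> * (\<integral>y. W y \<partial>lborel)" by (simp add: integral_completion)
  finally show "\<bar>(\<integral>y. h y * q y \<partial>lebesgue) - (\<integral>y. h y * \<gamma> y \<partial>lborel)\<bar>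
      \<le> c * \<delta> * (\<integral>y. exp (a * norm y) * ((1 + norm y ^ 3) * exp (- k * (norm y)\<^sup>2)) \<partial>(lborel :: (real^'m) measure))"
    by (simp add: W_def)
qed

lemma quotient_perturbation:
  fixes n d n0 d0 :: real
  assumes "\<bar>n - n0\<bar> \<le> e1" "\<bar>d - d0\<bar> \<le> e2" "d0 > 0" "e2 \<le> d0 / 2"
  shows "\<bar>n / d - n0 / d0\<bar> \<le> 2 / d0 * (e1 + \<bar>n0\<bar> * e2 / d0)"
proof -
  have d: "d \<ge> d0 / 2" using assms by (simp add: abs_le_iff)
  then have dpos: "d > 0" using assms by linarith
  have e2: "e2 \<ge> 0" and e1: "e1 \<ge> 0" using assms by linarith+
  have "n / d - n0 / d0 = ((n - n0) + n0 * (d0 - d) / d0) / d"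
    using dpos assms(3) by (simp add: field_simps)
  then have "\<bar>n / d - n0 / d0\<bar> = \<bar>(n - n0) + n0 * (d0 - d) / d0\<bar> / d"
    using dpos by simp
  also have "\<dots> \<le> (e1 + \<bar>n0\<bar> * e2 / d0) / d"
  proof (intro divide_right_mono order_trans[OF abs_triangle_ineq] add_mono assms(1))
    show "\<bar>n0 * (d0 - d) / d0\<bar> \<le> \<bar>n0\<bar> * e2 / d0"
      using assms by (auto simp: abs_mult abs_minus_commute intro!: divide_right_mono mult_left_mono)
  qed (use dpos in auto)
  also have "\<dots> \<le> (e1 + \<bar>n0\<bar> * e2 / d0) / (d0 / 2)"
    using d assms(3) e1 e2 by (intro divide_left_mono) auto
  finally show ?thesis by (simp add: mult.commute)
qed

text \<open>
  Completing the square: translation by \<open>matrix_inv A *v \<xi>\<close> absorbs the linear term.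
\<close>

lemma gaussian_exponential_moment:
  fixes A :: "real^'m^'m"
  assumes sym: "transpose A = A" and pos: "\<And>v. v \<noteq> 0 \<Longrightarrow> v \<bullet> (A *v v) > 0"
  shows "(\<integral>y. exp (\<xi> \<bullet> y) * exp (- (1/2) * (y \<bullet> (A *v y))) \<partial>lborel)
     = exp (1/2 * (\<xi> \<bullet> (matrix_inv A *v \<xi>))) * (\<integral>y. exp (- (1/2) * (y \<bullet> (A *v y))) \<partial>lborel)"
proof -
  have "invertible A" using gaussian_integral(1)[OF sym pos] by (simp add: invertible_det_nz)
  note inv = matrix_inv_mult[OF this]
  define c where "c = matrix_inv A *v \<xi>"
  have Ac: "A *v c = \<xi>" by (simp add: c_def matrix_vector_mul_assoc inv)
  have symA: "v \<bullet> (A *v w) = w \<bullet> (A *v v)" for v w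
    by (metis dot_lmul_matrix inner_commute sym vector_transpose_matrix)
  have sq: "exp (\<xi> \<bullet> (c + y)) * exp (- (1/2) * ((c + y) \<bullet> (A *v (c + y))))
     = exp (1/2 * (\<xi> \<bullet> c)) * exp (- (1/2) * (y \<bullet> (A *v y)))" for y
  proof -
    have "(c + y) \<bullet> (A *v (c + y)) = \<xi> \<bullet> c + 2 * (\<xi> \<bullet> y) + y \<bullet> (A *v y)"
      using symA[of c y] by (simp add: matrix_vector_right_distrib inner_add_left inner_add_right Ac inner_commute)
    then have "\<xi> \<bullet> (c + y) + - (1/2) * ((c + y) \<bullet> (A *v (c + y))) = 1/2 * (\<xi> \<bullet> c) + - (1/2) * (y \<bullet> (A *v y))"
      by (simp add: inner_add_right field_simps)
    then show ?thesis by (simp only: exp_add[symmetric])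
  qed
  have "(\<integral>y. exp (\<xi> \<bullet> y) * exp (- (1/2) * (y \<bullet> (A *v y))) \<partial>lborel)
    = (\<integral>y. exp (\<xi> \<bullet> y) * exp (- (1/2) * (y \<bullet> (A *v y))) \<partial>(distr lborel borel ((+) c)))"
    by (simp add: lborel_distr_plus)
  also have "\<dots> = (\<integral>y. exp (\<xi> \<bullet> (c + y)) * exp (- (1/2) * ((c + y) \<bullet> (A *v (c + y)))) \<partial>lborel)"
    by (rule integral_distr) measurable
  also have "\<dots> = exp (1/2 * (\<xi> \<bullet> c)) * (\<integral>y. exp (- (1/2) * (y \<bullet> (A *v y))) \<partial>lborel)"
    unfolding sq by simp
  finally show ?thesis by (simp add: c_def)
qed

lemma integral_multivariate_normal:
  fixes A :: "real^'m^'m" and g :: "real^'m \<Rightarrow> real"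
  assumes sym: "transpose A = A" and pos: "\<And>v. v \<noteq> 0 \<Longrightarrow> v \<bullet> (A *v v) > 0"
    and g[measurable]: "g \<in> borel_measurable borel"
  shows "(\<integral>y. g y \<partial>multivariate_normal 0 (matrix_inv A))
    = (\<integral>y. g y * exp (- (1/2) * (y \<bullet> (A *v y))) \<partial>lborel) / (\<integral>y. exp (- (1/2) * (y \<bullet> (A *v y))) \<partial>lborel)"
proof -
  note G = gaussian_integral[OF sym pos]
  have "invertible A" using G(1) by (simp add: invertible_det_nz)
  note inv = matrix_inv_mult[OF this]
  have "invertible (matrix_inv A)" unfolding invertible_def using inv by blast
  then have "matrix_inv (matrix_inv A) = A"
    using inv matrix_inv_mult[of "matrix_inv A"] by (metis matrix_mul_assoc matrix_mul_lid matrix_mul_rid)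
  moreover have "det (matrix_inv A) = 1 / det A"
    using G(1) inv(1) by (metis det_I det_mul less_irrefl nonzero_eq_divide_eq mult.commute)
  ultimately have "(\<integral>y. g y \<partial>multivariate_normal 0 (matrix_inv A)) =
     (\<integral>y. exp (- (1/2) * (y \<bullet> (A *v y))) / sqrt ((2 * pi) ^ CARD('m) / det A) * g y \<partial>lborel)"
    unfolding multivariate_normal_def using G(1) by (subst integral_density) auto
  also have "\<dots> = (\<integral>y. g y * exp (- (1/2) * (y \<bullet> (A *v y))) \<partial>lborel) / sqrt ((2 * pi) ^ CARD('m) / det A)"
    by (simp add: mult.commute)
  also have "sqrt ((2 * pi) ^ CARD('m) / det A) = (\<integral>y. exp (- (1/2) * (y \<bullet> (A *v y))) \<partial>lborel)"
    using G(2) by (simp add: has_bochner_integral_iff)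
  finally show ?thesis .
qed

lemma abs_exp_diff_le:
  fixes a b m :: real
  assumes "a \<le> m" "b \<le> m"
  shows "\<bar>exp a - exp b\<bar> \<le> \<bar>a - b\<bar> * exp m"
proof -
  have *: "exp x - exp y \<le> (x - y) * exp m" if "y \<le> x" "x \<le> m" for x y :: real
  proof -
    have "1 - exp (y - x) \<le> x - y" using exp_ge_add_one_self[of "y - x"] by linarith
    then have "(1 - exp (y - x)) * exp x \<le> (x - y) * exp x" by (intro mult_right_mono) auto
    also have "\<dots> \<le> (x - y) * exp m" using that by (intro mult_left_mono) auto
    finally show ?thesis by (simp add: algebra_simps exp_add[symmetric])
  qed
  show ?thesis using *[of b a] *[of a b] assms by (cases "b \<le> a") (auto simp: abs_if)
qed

section \<open>The rescaled density near the maximum\<close>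

text \<open>
  The central estimate. For \<open>y\<close> whose rescaled point lies in \<open>S\<close>, the two exponents differ by the
  remainder of the second-order expansion, and both are at most \<open>- k * (norm y)\<^sup>2\<close>. For the other
  \<open>y\<close>, the trivial bound \<open>exp (- k * (norm y)\<^sup>2)\<close> suffices, as \<open>1 \<le> norm y / (r * sqrt n)\<close>. The parameter \<open>\<eta>\<close> measures how far the second derivative at \<open>p\<close> may be from \<open>D\<close>.
\<close>

lemma rescaled_density_estimate:
  fixes g :: "'a::real_normed_vector \<Rightarrow> real" and n :: real
  assumes C2: "C2_with_lipschitz_Hessian S B g g1 g2" and S: "convex S" and B: "B \<ge> 0"
    and p: "p \<in> S" "g1 p = 0" and r: "r > 0" "ball p r \<subseteq> S" and SO: "S \<subseteq> \<Omega>"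
    and D: "\<And>z. z \<in> S \<Longrightarrow> norm (g2 z - D) \<le> B * norm (z - p) + \<eta>" and eta: "\<eta> \<ge> 0"
    and up: "\<And>x. x \<in> \<Omega> \<Longrightarrow> g x \<le> g p - k * (norm (x - p))\<^sup>2"
    and Dneg: "\<And>v. D v v \<le> - 2 * k * (norm v)\<^sup>2" and n: "n > 0"
  shows "\<bar>(if p + (- 1 / sqrt n) *\<^sub>R y \<in> \<Omega> then exp (n * (g (p + (- 1 / sqrt n) *\<^sub>R y) - g p)) else 0) - exp (1/2 * D y y)\<bar>
     \<le> (B + 1 + 1 / r) * (1 / sqrt n + \<eta>) * ((1 + norm y ^ 3) * exp (- k * (norm y)\<^sup>2))"
proof -
  define v where "v = (- 1 / sqrt n) *\<^sub>R y"
  define E where "E = exp (- k * (norm y)\<^sup>2)"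
  define W where "W = 1 + norm y ^ 3"
  have sn: "sqrt n > 0" using n by simp
  have nv: "norm v = norm y / sqrt n" using n by (simp add: v_def)
  have nv2: "n * (norm v)\<^sup>2 = (norm y)\<^sup>2" using n by (simp add: nv power_divide)
  have Dv: "n * D v v = D y y"
  proof -
    define c where "c = - 1 / sqrt n"
    have "n * (c * c) = 1" using n by (simp add: c_def)
    moreover have "D v v = (c * c) * D y y"
      unfolding v_def c_def[symmetric] by (simp add: blinfun.scaleR_left blinfun.scaleR_right)
    ultimately show ?thesis by (simp add: mult.assoc[symmetric])
  qed
  have gam: "1/2 * D y y \<le> - k * (norm y)\<^sup>2" using Dneg[of y] by simp
  have gup: "n * (g (p + v) - g p) \<le> - k * (norm y)\<^sup>2" if "p + v \<in> \<Omega>"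
  proof -
    have "g (p + v) - g p \<le> - k * (norm v)\<^sup>2" using up[OF that] by simp
    then have "n * (g (p + v) - g p) \<le> n * (- k * (norm v)\<^sup>2)" using n by (intro mult_left_mono) auto
    also have "\<dots> = - k * (n * (norm v)\<^sup>2)" by simp
    finally show ?thesis unfolding nv2 .
  qed
  have y1: "norm y \<le> W" and y2: "(norm y)\<^sup>2 \<le> W" and y3: "norm y ^ 3 \<le> W"
  proof -
    have "s \<le> 1 + s ^ 3 \<and> s\<^sup>2 \<le> 1 + s ^ 3" if "s \<ge> 0" for s :: real
    proof (cases "s \<le> 1")
      case True
      then have "s\<^sup>2 \<le> 1" "s ^ 3 \<ge> 0" using that by (auto simp: power_le_one)
      then show ?thesis using True by linarith
    next
      case False
      then have "s ^ 1 \<le> s ^ 3" "s ^ 2 \<le> s ^ 3" by (intro power_increasing; simp)+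
      then show ?thesis by simp
    qed
    from this[of "norm y"] show "norm y \<le> W" "(norm y)\<^sup>2 \<le> W" "norm y ^ 3 \<le> W" by (auto simp: W_def)
  qed
  have W0: "W \<ge> 0" by (simp add: W_def)
  let ?q = "if p + v \<in> \<Omega> then exp (n * (g (p + v) - g p)) else 0"
  have "\<bar>?q - exp (1/2 * D y y)\<bar> \<le> (B + 1 + 1 / r) * (1 / sqrt n + \<eta>) * W * E"
  proof (cases "p + v \<in> S")
    case True
    have "\<bar>g (p + 1 *\<^sub>R v) - g (p + 0 *\<^sub>R v) - g1 (p + 0 *\<^sub>R v) v - D v v / 2\<bar> \<le> (B * norm v + \<eta>) * (norm v)\<^sup>2 / 2"
    proof (rule second_order_error_bound[OF C2_segment_derivatives(1,2)[OF C2 S p(1) True]])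
      fix t :: real assume t: "t \<in> {0..1}"
      have z: "p + t *\<^sub>R v \<in> S" by (rule C2_segment_derivatives(3)[OF C2 S p(1) True t])
      have "\<bar>g2 (p + t *\<^sub>R v) v v - D v v\<bar> = \<bar>(g2 (p + t *\<^sub>R v) - D) v v\<bar>"
        by (simp add: blinfun.diff_left)
      also have "\<dots> \<le> norm (g2 (p + t *\<^sub>R v) - D) * norm v * norm v" by (rule abs_bilinear_le)
      also have "\<dots> \<le> (B * norm (t *\<^sub>R v) + \<eta>) * norm v * norm v"
        using D[OF z] by (intro mult_right_mono) auto
      also have "\<dots> \<le> (B * norm v + \<eta>) * norm v * norm v"
        using t by (intro mult_right_mono add_mono mult_left_mono B norm_ge_zero) (auto intro: mult_left_le_one_le)
      finally show "\<bar>g2 (p + t *\<^sub>R v) v v - D v v\<bar> \<le> (B * norm v + \<eta>) * (norm v)\<^sup>2"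
        by (simp add: power2_eq_square mult.assoc)
    qed
    then have "\<bar>g (p + v) - g p - D v v / 2\<bar> \<le> (B * norm v + \<eta>) * (norm v)\<^sup>2 / 2"
      by (simp add: p)
    then have "n * \<bar>g (p + v) - g p - D v v / 2\<bar> \<le> n * ((B * norm v + \<eta>) * (norm v)\<^sup>2 / 2)"
      using n by (intro mult_left_mono) auto
    also have "\<dots> = (B * norm v + \<eta>) * (n * (norm v)\<^sup>2) / 2" by simp
    also have "\<dots> = (B * (norm y ^ 3 / sqrt n) + \<eta> * (norm y)\<^sup>2) / 2"
      unfolding nv2 by (simp add: nv power2_eq_square power3_eq_cube algebra_simps)
    also have "\<dots> \<le> B * (norm y ^ 3 / sqrt n) + \<eta> * (norm y)\<^sup>2"
      using B eta sn by (simp add: field_simps)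
    also have "\<dots> \<le> B * (W / sqrt n) + \<eta> * W"
      using B eta y2 y3 sn by (intro add_mono mult_left_mono divide_right_mono) auto
    also have "n * \<bar>g (p + v) - g p - D v v / 2\<bar> = \<bar>n * (g (p + v) - g p) - 1/2 * D y y\<bar>"
    proof -
      have "n * (g (p + v) - g p) - 1/2 * D y y = n * (g (p + v) - g p - D v v / 2)"
        by (simp add: Dv[symmetric] algebra_simps)
      then show ?thesis using n by (simp add: abs_mult)
    qed
    finally have diff: "\<bar>n * (g (p + v) - g p) - 1/2 * D y y\<bar> \<le> (B / sqrt n + \<eta>) * W"
      by (simp add: algebra_simps)
    have inO: "p + v \<in> \<Omega>" using True SO by blast
    have "\<bar>exp (n * (g (p + v) - g p)) - exp (1/2 * D y y)\<bar> \<le> \<bar>n * (g (p + v) - g p) - 1/2 * D y y\<bar> * E"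
      unfolding E_def by (rule abs_exp_diff_le[OF gup[OF inO] gam])
    also have "\<dots> \<le> (B / sqrt n + \<eta>) * W * E"
      by (intro mult_right_mono diff) (simp add: E_def)
    also have "\<dots> \<le> (B + 1 + 1 / r) * (1 / sqrt n + \<eta>) * W * E"
    proof (intro mult_right_mono)
      have "B / sqrt n \<le> (B + 1 + 1/r) / sqrt n" using r sn by (intro divide_right_mono) auto
      moreover have "1 * \<eta> \<le> (B + 1 + 1/r) * \<eta>" using r B eta by (intro mult_right_mono) auto
      ultimately show "B / sqrt n + \<eta> \<le> (B + 1 + 1 / r) * (1 / sqrt n + \<eta>)" by (simp add: distrib_left)
    qed (use W0 in \<open>auto simp: E_def\<close>)
    finally show ?thesis using inO by simp
  next
    case False
    then have "p + v \<notin> ball p r" using r by blast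
    then have "r \<le> norm y / sqrt n" by (simp add: dist_norm nv)
    also have "\<dots> \<le> W / sqrt n" using y1 sn by (intro divide_right_mono) auto
    finally have "1 \<le> (W / sqrt n) / r" by (simp only: le_divide_eq_1_pos[OF r(1)])
    then have one: "1 \<le> 1 / r * (1 / sqrt n) * W" by (simp add: mult.commute)
    have "0 \<le> ?q" "?q \<le> E" using gup by (auto simp: E_def)
    moreover have "0 \<le> exp (1/2 * D y y)" "exp (1/2 * D y y) \<le> E" using gam by (auto simp: E_def)
    ultimately have "\<bar>?q - exp (1/2 * D y y)\<bar> \<le> 1 * E" by linarith
    also have "\<dots> \<le> (1 / r * (1 / sqrt n) * W) * E" by (intro mult_right_mono one) (simp add: E_def)
    also have "\<dots> \<le> (B + 1 + 1 / r) * (1 / sqrt n + \<eta>) * W * E"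
      using W0 B r sn eta by (intro mult_right_mono mult_mono) (auto simp: E_def)
    finally show ?thesis .
  qed
  then show ?thesis by (simp only: v_def E_def W_def mult.assoc)
qed

section \<open>Expectations under the rescaled law\<close>

lemma lebesgue_affine_scaleR:
  fixes p :: "'a::euclidean_space"
  assumes t: "t \<noteq> 0"
  shows "(\<lambda>y. p + t *\<^sub>R y) \<in> lebesgue \<rightarrow>\<^sub>M lebesgue"
    and "F \<in> borel_measurable lebesgue \<Longrightarrow>
      (\<integral>x. F x \<partial>lebesgue) = \<bar>t\<bar> ^ DIM('a) * (\<integral>y. (F (p + t *\<^sub>R y) :: real) \<partial>lebesgue)"
proof -
  have T: "(\<lambda>y. p + (\<Sum>j\<in>Basis. (t * (y \<bullet> j)) *\<^sub>R j)) = (\<lambda>y. p + t *\<^sub>R y)"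
    by (simp add: scaleR_scaleR[symmetric] scaleR_sum_right[symmetric] euclidean_representation del: scaleR_scaleR)
  show m: "(\<lambda>y. p + t *\<^sub>R y) \<in> lebesgue \<rightarrow>\<^sub>M lebesgue"
    using lebesgue_affine_measurable[of "\<lambda>_. t" p] t unfolding T by simp
  assume F: "F \<in> borel_measurable lebesgue"
  have eq: "lebesgue = density (distr lebesgue lebesgue (\<lambda>y. p + t *\<^sub>R y)) (\<lambda>_. ennreal (\<bar>t\<bar> ^ DIM('a)))"
    using lebesgue_affine_euclidean[of "\<lambda>_. t" p] t unfolding T by (simp add: ennreal_power)
  have "(\<integral>x. F x \<partial>lebesgue) = (\<integral>x. F x \<partial>(density (distr lebesgue lebesgue (\<lambda>y. p + t *\<^sub>R y)) (\<lambda>_. ennreal (\<bar>t\<bar> ^ DIM('a)))))"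
    using eq by simp
  also have "\<dots> = \<bar>t\<bar> ^ DIM('a) * (\<integral>x. F x \<partial>(distr lebesgue lebesgue (\<lambda>y. p + t *\<^sub>R y)))"
    using F by (subst integral_density) auto
  also have "(\<integral>x. F x \<partial>(distr lebesgue lebesgue (\<lambda>y. p + t *\<^sub>R y))) = (\<integral>y. F (p + t *\<^sub>R y) \<partial>lebesgue)"
    using m F by (rule integral_distr)
  finally show "(\<integral>x. F x \<partial>lebesgue) = \<bar>t\<bar> ^ DIM('a) * (\<integral>y. F (p + t *\<^sub>R y) \<partial>lebesgue)" .
qed

text \<open>
  Since \<open>w\<close> is only Lebesgue measurable, the law of \<open>X\<close> is compared on Borel sets with the image of a
  density over the completed measure. The normalizing integral is not assumed to be nonzero: otherwise
  \<open>X\<close> would lie in \<open>\<Omega>\<close> with probability \<open>0 / 0 = 0\<close>.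
\<close>

lemma expectation_of_density:
  fixes X :: "'w \<Rightarrow> 'a::euclidean_space" and w h :: "'a \<Rightarrow> real"
  assumes M: "prob_space M" and X[measurable]: "X \<in> borel_measurable M"
    and XO: "\<And>\<omega>. \<omega> \<in> space M \<Longrightarrow> X \<omega> \<in> \<Omega>" and O: "open \<Omega>"
    and w: "set_integrable lebesgue \<Omega> w" "\<And>x. w x \<ge> 0"
    and distr: "\<And>A. A \<in> sets borel \<Longrightarrow> A \<subseteq> \<Omega> \<Longrightarrow>
        measure M {\<omega> \<in> space M. X \<omega> \<in> A} = (LINT x:A|lebesgue. w x) / (LINT x:\<Omega>|lebesgue. w x)"
    and h[measurable]: "h \<in> borel_measurable borel"
  shows "(\<integral>\<omega>. h (X \<omega>) \<partial>M) = (LINT x:\<Omega>|lebesgue. h x * w x) / (LINT x:\<Omega>|lebesgue. w x)"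
proof -
  interpret prob_space M by (rule M)
  define c where "c = (LINT x:\<Omega>|lebesgue. w x)"
  have Ob: "\<Omega> \<in> sets borel" using O by simp
  have "{\<omega> \<in> space M. X \<omega> \<in> \<Omega>} = space M" using XO by auto
  then have "1 = c / c" using distr[OF Ob] prob_space by (simp add: c_def)
  then have c0: "c \<noteq> 0" by auto
  have "c \<ge> 0" unfolding c_def set_lebesgue_integral_def using w(2) by (intro integral_nonneg_AE) auto
  then have c: "c > 0" using c0 by simp
  define d where "d = (\<lambda>x. indicator \<Omega> x * w x / c)"
  have int: "integrable lebesgue (\<lambda>x. indicator \<Omega> x * w x)"
    using w(1) by (simp add: set_integrable_def)
  then have d[measurable]: "d \<in> borel_measurable lebesgue" unfolding d_def by auto
  have d0: "d x \<ge> 0" for x using w(2) c by (simp add: d_def)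
  have intd: "integrable lebesgue d" unfolding d_def using int by auto
  have id[measurable]: "(\<lambda>x. x) \<in> measurable lebesgue borel"
    by (simp add: measurable_completion)
  have "distr M borel X = distr (density lebesgue (\<lambda>x. ennreal (d x))) borel (\<lambda>x. x)"
  proof (rule measure_eqI)
    fix A assume "A \<in> sets (distr M borel X)"
    then have A[measurable]: "A \<in> sets borel" by simp
    have Al: "A \<in> sets lebesgue" using A by simp
    have AO: "A \<inter> \<Omega> \<in> sets borel" using A Ob by blast
    have "X -` A \<inter> space M = {\<omega> \<in> space M. X \<omega> \<in> A \<inter> \<Omega>}" using XO by auto
    then have "emeasure (distr M borel X) A = ennreal ((LINT x:A \<inter> \<Omega>|lebesgue. w x) / c)"
      using distr[OF AO] A by (simp add: emeasure_distr emeasure_eq_measure c_def)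
    also have "(LINT x:A \<inter> \<Omega>|lebesgue. w x) / c = (\<integral>x. d x * indicator A x \<partial>lebesgue)"
      unfolding set_lebesgue_integral_def d_def
      by (subst Bochner_Integration.integral_divide_zero[symmetric]) (auto intro!: Bochner_Integration.integral_cong split: split_indicator)
    also have "ennreal \<dots> = (\<integral>\<^sup>+x. ennreal (d x * indicator A x) \<partial>lebesgue)"
      by (rule nn_integral_eq_integral[symmetric])
        (use d0 in \<open>auto intro!: integrable_real_mult_indicator[OF Al intd] AE_I2\<close>)
    also have "\<dots> = (\<integral>\<^sup>+x. ennreal (d x) * indicator A x \<partial>lebesgue)"
      by (intro nn_integral_cong) (auto split: split_indicator)
    also have "\<dots> = emeasure (density lebesgue (\<lambda>x. ennreal (d x))) A"
      using Al by (subst emeasure_density) auto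
    also have "\<dots> = emeasure (distr (density lebesgue (\<lambda>x. ennreal (d x))) borel (\<lambda>x. x)) A"
      by (subst emeasure_distr) auto
    finally show "emeasure (distr M borel X) A = emeasure (distr (density lebesgue (\<lambda>x. ennreal (d x))) borel (\<lambda>x. x)) A" .
  qed simp
  then have "(\<integral>x. h x \<partial>(distr M borel X)) = (\<integral>x. h x \<partial>(distr (density lebesgue (\<lambda>x. ennreal (d x))) borel (\<lambda>x. x)))"
    by simp
  then have "(\<integral>\<omega>. h (X \<omega>) \<partial>M) = (\<integral>x. h x \<partial>(density lebesgue (\<lambda>x. ennreal (d x))))"
    by (simp add: integral_distr)
  also have "\<dots> = (\<integral>x. d x * h x \<partial>lebesgue)"
    using d0 by (subst integral_density) (auto simp: measurable_completion)
  also have "\<dots> = (LINT x:\<Omega>|lebesgue. h x * w x) / c"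
    unfolding set_lebesgue_integral_def d_def
    by (subst Bochner_Integration.integral_divide_zero[symmetric]) (auto intro!: Bochner_Integration.integral_cong)
  finally show ?thesis by (simp add: c_def)
qed

text \<open>
  The Jacobian of the substitution and the factor \<open>exp (n * g p)\<close> cancel in the quotient.
\<close>

lemma expectation_rescaled:
  fixes X :: "'w \<Rightarrow> 'a::euclidean_space" and g h :: "'a \<Rightarrow> real" and p :: 'a
  assumes M: "prob_space M" "X \<in> borel_measurable M"
    "\<And>\<omega>. \<omega> \<in> space M \<Longrightarrow> X \<omega> \<in> \<Omega>" and O: "open \<Omega>"
    and int: "set_integrable lebesgue \<Omega> (\<lambda>x. exp (n * g x))"
    and distr: "\<And>A. A \<in> sets borel \<Longrightarrow> A \<subseteq> \<Omega> \<Longrightarrow>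
        measure M {\<omega> \<in> space M. X \<omega> \<in> A} = (LINT x:A|lebesgue. exp (n * g x)) / (LINT x:\<Omega>|lebesgue. exp (n * g x))"
    and h[measurable]: "h \<in> borel_measurable borel" and t: "t \<noteq> 0"
  defines "q \<equiv> \<lambda>y. if p + t *\<^sub>R y \<in> \<Omega> then exp (n * (g (p + t *\<^sub>R y) - g p)) else 0"
  shows "q \<in> borel_measurable lebesgue"
    and "(\<integral>\<omega>. h (X \<omega>) \<partial>M) = (\<integral>y. h (p + t *\<^sub>R y) * q y \<partial>lebesgue) / (\<integral>y. q y \<partial>lebesgue)"
proof -
  define F where "F = (\<lambda>x. indicator \<Omega> x * exp (n * g x))"
  have F[measurable]: "F \<in> borel_measurable lebesgue"
    using int unfolding set_integrable_def F_def by auto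
  define a where "a = exp (n * g p)"
  have a: "a > 0" by (simp add: a_def)
  have qF: "F (p + t *\<^sub>R y) = a * q y" for y
    by (auto simp: F_def q_def a_def exp_add[symmetric] algebra_simps)
  note T = lebesgue_affine_scaleR(1)[OF t, of p]
  have "(\<lambda>y. F (p + t *\<^sub>R y) / a) \<in> borel_measurable lebesgue"
    using measurable_compose[OF T F] by simp
  then show q: "q \<in> borel_measurable lebesgue" using a by (simp add: qF)
  have hl[measurable]: "h \<in> borel_measurable lebesgue" by (simp add: measurable_completion)
  have "(\<integral>\<omega>. h (X \<omega>) \<partial>M) = (LINT x:\<Omega>|lebesgue. h x * exp (n * g x)) / (LINT x:\<Omega>|lebesgue. exp (n * g x))"
    by (rule expectation_of_density[OF M O int _ distr h]) auto
  also have "(LINT x:\<Omega>|lebesgue. h x * exp (n * g x)) = (\<integral>x. h x * F x \<partial>lebesgue)"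
    by (simp add: set_lebesgue_integral_def F_def mult_ac)
  also have "\<dots> = \<bar>t\<bar> ^ DIM('a) * (\<integral>y. h (p + t *\<^sub>R y) * F (p + t *\<^sub>R y) \<partial>lebesgue)"
    by (rule lebesgue_affine_scaleR(2)[OF t]) measurable
  also have "\<dots> = \<bar>t\<bar> ^ DIM('a) * (a * (\<integral>y. h (p + t *\<^sub>R y) * q y \<partial>lebesgue))"
    unfolding qF by (simp add: mult.left_commute)
  also have "(LINT x:\<Omega>|lebesgue. exp (n * g x)) = (\<integral>x. F x \<partial>lebesgue)"
    by (simp add: set_lebesgue_integral_def F_def)
  also have "\<dots> = \<bar>t\<bar> ^ DIM('a) * (\<integral>y. F (p + t *\<^sub>R y) \<partial>lebesgue)"
    by (rule lebesgue_affine_scaleR(2)[OF t]) measurable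
  also have "\<dots> = \<bar>t\<bar> ^ DIM('a) * (a * (\<integral>y. q y \<partial>lebesgue))"
    unfolding qF by simp
  finally show "(\<integral>\<omega>. h (X \<omega>) \<partial>M) = (\<integral>y. h (p + t *\<^sub>R y) * q y \<partial>lebesgue) / (\<integral>y. q y \<partial>lebesgue)"
    using a t by simp
qed

text \<open>
  Uniform over all Borel weights with the growth bound: quotients of integrals of \<open>q N\<close> differ from the
  corresponding quotients for \<open>\<gamma>\<close> by \<open>O(\<delta> N)\<close>.
\<close>

lemma normalized_integral_perturbation:
  fixes A :: "real^'m^'m" and q :: "nat \<Rightarrow> real^'m \<Rightarrow> real" and \<delta> :: "nat \<Rightarrow> real"
  assumes \<gamma>_def: "\<gamma> = (\<lambda>y. exp (- (1/2) * (y \<bullet> (A *v y))))"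
    and sym: "transpose A = A" and pos: "\<And>v. v \<noteq> 0 \<Longrightarrow> v \<bullet> (A *v v) > 0"
    and k: "k > 0" "\<And>v. v \<bullet> (A *v v) \<ge> 2 * k * (norm v)\<^sup>2"
    and K: "K \<ge> 0" and \<delta>: "\<delta> \<longlonglongrightarrow> 0" and a: "a \<ge> 0"
    and q: "\<forall>\<^sub>F N in sequentially. q N \<in> borel_measurable lebesgue \<and>
      (\<forall>y. \<bar>q N y - \<gamma> y\<bar> \<le> K * \<delta> N * ((1 + norm y ^ 3) * exp (- k * (norm y)\<^sup>2)))"
  shows "\<exists>K'\<ge>0. \<forall>\<^sub>F N in sequentially. \<forall>h\<in>borel_measurable borel. \<forall>c\<ge>0.
    (\<forall>y. \<bar>h y\<bar> \<le> c * exp (a * norm y)) \<longrightarrow>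
    \<bar>(\<integral>y. h y * q N y \<partial>lebesgue) / (\<integral>y. q N y \<partial>lebesgue) - (\<integral>y. h y * \<gamma> y \<partial>lborel) / (\<integral>y. \<gamma> y \<partial>lborel)\<bar>
      \<le> c * K' * \<delta> N"
proof -
  define W where "W a = (\<integral>y. exp (a * norm y) * ((1 + norm y ^ 3) * exp (- k * (norm y)\<^sup>2)) \<partial>(lborel :: (real^'m) measure))" for a
  have W0: "W a \<ge> 0" for a unfolding W_def by (intro integral_nonneg_AE) auto
  define d0 where "d0 = (\<integral>y. \<gamma> y \<partial>lborel)"
  note G = gaussian_integral[OF sym pos]
  have d0: "d0 > 0"
    using G by (simp add: d0_def \<gamma>_def has_bochner_integral_iff)
  have \<gamma>m: "\<gamma> \<in> borel_measurable borel" unfolding \<gamma>_def by measurable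
  have \<gamma>b: "\<bar>\<gamma> y\<bar> \<le> exp (- k * (norm y)\<^sup>2)" for y
    using k(2)[of y] by (simp add: \<gamma>_def)
  define K' where "K' = 2 / d0 * (K * W a + W a * K * W 0 / d0)"
  have K': "K' \<ge> 0" using d0 K W0 by (simp add: K'_def)
  have "(\<lambda>N. K * \<delta> N * W 0) \<longlonglongrightarrow> K * 0 * W 0" by (intro tendsto_intros \<delta>)
  then have "\<forall>\<^sub>F N in sequentially. K * \<delta> N * W 0 < d0 / 2"
    using d0 by (intro order_tendstoD(2)) auto
  with q have "\<forall>\<^sub>F N in sequentially. \<forall>h\<in>borel_measurable borel. \<forall>c\<ge>0.
    (\<forall>y. \<bar>h y\<bar> \<le> c * exp (a * norm y)) \<longrightarrow>
    \<bar>(\<integral>y. h y * q N y \<partial>lebesgue) / (\<integral>y. q N y \<partial>lebesgue) - (\<integral>y. h y * \<gamma> y \<partial>lborel) / d0\<bar>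
      \<le> c * K' * \<delta> N"
  proof (eventually_elim, intro ballI allI impI)
    fix N c and h :: "real^'m \<Rightarrow> real"
    assume q: "q N \<in> borel_measurable lebesgue \<and>
      (\<forall>y. \<bar>q N y - \<gamma> y\<bar> \<le> K * \<delta> N * ((1 + norm y ^ 3) * exp (- k * (norm y)\<^sup>2)))"
      and small: "K * \<delta> N * W 0 < d0 / 2"
      and h: "h \<in> borel_measurable borel" and c: "c \<ge> 0" and hb: "\<forall>y. \<bar>h y\<bar> \<le> c * exp (a * norm y)"
    note P = weighted_gaussian_perturbation[OF k(1) _ conjunct1[OF q] _ \<gamma>m spec[OF conjunct2[OF q]] \<gamma>b]
    have n: "\<bar>(\<integral>y. h y * q N y \<partial>lebesgue) - (\<integral>y. h y * \<gamma> y \<partial>lborel)\<bar> \<le> c * (K * \<delta> N) * W a"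
      unfolding W_def by (rule P(4)[OF a h spec[OF hb] c])
    have d: "\<bar>(\<integral>y. q N y \<partial>lebesgue) - d0\<bar> \<le> K * \<delta> N * W 0"
      using P(4)[of 0 "\<lambda>_. 1" 1] by (simp add: W_def d0_def)
    have n0: "\<bar>\<integral>y. h y * \<gamma> y \<partial>lborel\<bar> \<le> c * W a"
      unfolding W_def by (rule P(2)[OF a h spec[OF hb] c])
    have dd: "K * \<delta> N * W 0 \<ge> 0" using d by linarith
    have "\<bar>(\<integral>y. h y * q N y \<partial>lebesgue) / (\<integral>y. q N y \<partial>lebesgue) - (\<integral>y. h y * \<gamma> y \<partial>lborel) / d0\<bar>
      \<le> 2 / d0 * (c * (K * \<delta> N) * W a + \<bar>\<integral>y. h y * \<gamma> y \<partial>lborel\<bar> * (K * \<delta> N * W 0) / d0)"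
      by (rule quotient_perturbation[OF n d d0]) (use small in simp)
    also have "\<dots> \<le> 2 / d0 * (c * (K * \<delta> N) * W a + (c * W a) * (K * \<delta> N * W 0) / d0)"
      using d0 dd n0 by (intro mult_left_mono add_left_mono divide_right_mono mult_right_mono) auto
    also have "\<dots> = c * K' * \<delta> N" by (simp add: K'_def algebra_simps)
    finally show "\<bar>(\<integral>y. h y * q N y \<partial>lebesgue) / (\<integral>y. q N y \<partial>lebesgue) - (\<integral>y. h y * \<gamma> y \<partial>lborel) / d0\<bar>
      \<le> c * K' * \<delta> N" .
  qed
  then show ?thesis using K' unfolding d0_def by blast
qed

section \<open>Derivatives of the perturbed function\<close>

lemma blinfun_has_derivative_unique:
  assumes "(g has_derivative blinfun_apply a) (at x)" "(g has_derivative blinfun_apply b) (at x)"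
  shows "a = b"
  using has_derivative_unique[OF assms] by (simp add: blinfun_apply_inject)

lemma blinfun_apply_add_scaleR:
  "blinfun_apply (F + e *\<^sub>R G) = (\<lambda>v. F v + e *\<^sub>R G v)"
  by (simp add: fun_eq_iff blinfun.add_left blinfun.scaleR_left)

text \<open>
  At an interior point, derivatives within \<open>S\<close> are ordinary derivatives, so those of \<open>f0 + e * \<sigma>\<close> can be
  computed from those of \<open>f0\<close> and \<open>\<sigma>\<close>, which are only known to exist near \<open>x\<close>.
\<close>

lemma derivatives_of_perturbation:
  fixes g f0 \<sigma> :: "'a::real_normed_vector \<Rightarrow> real"
  assumes C2: "C2_with_lipschitz_Hessian S B g g1 g2" and x: "x \<in> interior S"
    and eq: "\<And>y. y \<in> S \<Longrightarrow> g y = f0 y + e * \<sigma> y"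
    and f0: "twice_differentiable_at f0 x" and \<sigma>: "twice_differentiable_at \<sigma> x"
  shows "g1 x = Dwithin UNIV f0 x + e *\<^sub>R Dwithin UNIV \<sigma> x"
    and "g2 x = Dwithin UNIV (Dwithin UNIV f0) x + e *\<^sub>R Dwithin UNIV (Dwithin UNIV \<sigma>) x"
proof -
  have d: "(g has_derivative blinfun_apply (g1 y)) (at y)" "(g1 has_derivative blinfun_apply (g2 y)) (at y)"
    if "y \<in> interior S" for y
    using C2 that interior_subset unfolding C2_with_lipschitz_Hessian_def by (metis at_within_interior subsetD)+
  have "\<forall>\<^sub>F y in nhds x. y \<in> interior S"
    using x by (intro eventually_nhds_in_open) auto
  moreover have "\<forall>\<^sub>F y in nhds x. f0 differentiable (at y)" "\<forall>\<^sub>F y in nhds x. \<sigma> differentiable (at y)"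
    using f0 \<sigma> by (auto simp: twice_differentiable_at_def)
  ultimately have ev: "\<forall>\<^sub>F y in nhds x. g1 y = Dwithin UNIV f0 y + e *\<^sub>R Dwithin UNIV \<sigma> y"
  proof eventually_elim
    fix y assume y: "y \<in> interior S" and "f0 differentiable (at y)" "\<sigma> differentiable (at y)"
    then have "((\<lambda>y. f0 y + e * \<sigma> y) has_derivative (\<lambda>v. Dwithin UNIV f0 y v + e * Dwithin UNIV \<sigma> y v)) (at y)"
      by (intro derivative_intros Dwithin_has_derivative)
    then have "(g has_derivative (\<lambda>v. Dwithin UNIV f0 y v + e * Dwithin UNIV \<sigma> y v)) (at y)"
      by (rule has_derivative_transform_within_open[OF _ open_interior y]) (use eq interior_subset in force)
    then have "(g has_derivative blinfun_apply (Dwithin UNIV f0 y + e *\<^sub>R Dwithin UNIV \<sigma> y)) (at y)"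
      by (simp add: blinfun_apply_add_scaleR)
    then show "g1 y = Dwithin UNIV f0 y + e *\<^sub>R Dwithin UNIV \<sigma> y"
      by (rule blinfun_has_derivative_unique[OF d(1)[OF y]])
  qed
  then show "g1 x = Dwithin UNIV f0 x + e *\<^sub>R Dwithin UNIV \<sigma> x"
    by (rule eventually_nhds_x_imp_x)
  have der: "((\<lambda>y. Dwithin UNIV f0 y + e *\<^sub>R Dwithin UNIV \<sigma> y) has_derivative
      (\<lambda>v. Dwithin UNIV (Dwithin UNIV f0) x v + e *\<^sub>R Dwithin UNIV (Dwithin UNIV \<sigma>) x v)) (at x)"
    using f0 \<sigma> unfolding twice_differentiable_at_def
    by (intro derivative_intros Dwithin_has_derivative) auto
  obtain U where U: "open U" "x \<in> U" "\<And>y. y \<in> U \<Longrightarrow> g1 y = Dwithin UNIV f0 y + e *\<^sub>R Dwithin UNIV \<sigma> y"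
    using ev unfolding eventually_nhds by blast
  have "(g1 has_derivative
      (\<lambda>v. Dwithin UNIV (Dwithin UNIV f0) x v + e *\<^sub>R Dwithin UNIV (Dwithin UNIV \<sigma>) x v)) (at x)"
    by (rule has_derivative_transform_within_open[OF der U(1,2)]) (simp add: U(3))
  then have "(g1 has_derivative
      blinfun_apply (Dwithin UNIV (Dwithin UNIV f0) x + e *\<^sub>R Dwithin UNIV (Dwithin UNIV \<sigma>) x)) (at x)"
    by (simp add: blinfun_apply_add_scaleR)
  then show "g2 x = Dwithin UNIV (Dwithin UNIV f0) x + e *\<^sub>R Dwithin UNIV (Dwithin UNIV \<sigma>) x"
    by (rule blinfun_has_derivative_unique[OF d(2)[OF x]])
qed

lemma gradient_lipschitz:
  assumes C2: "C2_with_lipschitz_Hessian S B g g1 g2" and S: "convex S"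
    and b: "\<And>x. x \<in> S \<Longrightarrow> norm (g2 x) \<le> b" and xy: "x \<in> S" "y \<in> S"
  shows "norm (g1 x - g1 y) \<le> b * norm (x - y)"
  by (rule differentiable_bound[OF S _ _ xy, where f'="\<lambda>x. blinfun_apply (g2 x)"])
    (use C2 b in \<open>auto simp: C2_with_lipschitz_Hessian_def norm_blinfun.rep_eq[symmetric]\<close>)

lemma matrix_inv_uminus:
  fixes H :: "real^'m^'m"
  assumes "invertible H"
  shows "matrix_inv (- H) = - matrix_inv H"
proof -
  note inv = matrix_inv_mult[OF assms]
  have neg: "(- X) ** (- Y) = X ** Y" for X Y :: "real^'m^'m"
    by (simp add: matrix_matrix_mult_def)
  have "(- H) ** (- matrix_inv H) = mat 1" "(- matrix_inv H) ** (- H) = mat 1"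
    using inv by (simp_all add: neg)
  moreover from this have "invertible (- H)" unfolding invertible_def by blast
  ultimately show ?thesis
    using matrix_inv_mult[of "- H"] by (metis matrix_mul_assoc matrix_mul_lid matrix_mul_rid)
qed

lemma tendsto_integral_shift:
  fixes \<gamma> g :: "'a::euclidean_space \<Rightarrow> real" and s :: "nat \<Rightarrow> 'a"
  assumes g: "continuous_on UNIV g" "\<And>y. \<bar>g y\<bar> \<le> c" and \<gamma>: "integrable lborel \<gamma>" and s: "s \<longlonglongrightarrow> 0"
  shows "(\<lambda>N. \<integral>y. g (s N + y) * \<gamma> y \<partial>lborel) \<longlonglongrightarrow> (\<integral>y. g y * \<gamma> y \<partial>lborel)"
proof (rule integral_dominated_convergence)
  have gm[measurable]: "g \<in> borel_measurable borel" by (rule borel_measurable_continuous_onI[OF g(1)])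
  have \<gamma>m[measurable]: "\<gamma> \<in> borel_measurable borel" using \<gamma> by simp
  show "(\<lambda>y. g y * \<gamma> y) \<in> borel_measurable lborel" by measurable
  show "(\<lambda>y. g (s N + y) * \<gamma> y) \<in> borel_measurable lborel" for N by measurable
  show "integrable lborel (\<lambda>y. c * \<bar>\<gamma> y\<bar>)" using \<gamma> by auto
  show "AE y in lborel. norm (g (s N + y) * \<gamma> y) \<le> c * \<bar>\<gamma> y\<bar>" for N
    using g(2) by (auto simp: abs_mult intro!: AE_I2 mult_right_mono)
  show "AE y in lborel. (\<lambda>N. g (s N + y) * \<gamma> y) \<longlonglongrightarrow> g y * \<gamma> y"
  proof (rule AE_I2)
    fix y
    have "(\<lambda>N. s N + y) \<longlonglongrightarrow> 0 + y" by (intro tendsto_intros s)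
    then have "(\<lambda>N. g (s N + y)) \<longlonglongrightarrow> g (0 + y)"
      by (rule continuous_on_tendsto_compose[OF g(1)]) auto
    then show "(\<lambda>N. g (s N + y) * \<gamma> y) \<longlonglongrightarrow> g y * \<gamma> y" by (auto intro: tendsto_intros)
  qed
qed

section \<open>Asymptotic normality\<close>

theorem theorem5:
  fixes \<Omega> \<Omega>' :: "(real^'m) set"
    and r C :: real
    and f :: "real^'m \<Rightarrow> nat \<Rightarrow> real"
    and f0 \<sigma> :: "real^'m \<Rightarrow> real"
    and \<epsilon> :: "nat \<Rightarrow> real"
    and N0 :: nat
    and xs :: "nat \<Rightarrow> real^'m"
    and xstar :: "real^'m"
    and P :: "nat \<Rightarrow> 'w measure"
    and X :: "nat \<Rightarrow> 'w \<Rightarrow> real^'m"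
    and Z :: "nat \<Rightarrow> 'w \<Rightarrow> real^'m"
  assumes Omega: "open \<Omega>" "bounded \<Omega>"
    and Omega': "r > 0" "\<Omega>' = cball 0 r" "\<Omega>' \<subset> \<Omega>"
    and diff3: "\<And>N. N \<ge> 1 \<Longrightarrow> three_times_differentiable_on (\<lambda>x. f x N) \<Omega>'"
    and unif_bounded: "\<exists>B. \<forall>N\<ge>1. \<forall>x\<in>\<Omega>'.
      \<bar>f x N\<bar> \<le> B \<and>
      norm (Dwithin \<Omega>' (\<lambda>y. f y N) x) \<le> B \<and>
      norm (Dwithin \<Omega>' (Dwithin \<Omega>' (\<lambda>y. f y N)) x) \<le> B \<and>
      norm (Dwithin \<Omega>' (Dwithin \<Omega>' (Dwithin \<Omega>' (\<lambda>y. f y N))) x) \<le> B"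
    and nonsingular: "\<And>N x. N \<ge> 1 \<Longrightarrow> x \<in> \<Omega>' \<Longrightarrow> invertible (hessian_within \<Omega>' (\<lambda>y. f y N) x)"
    and N0: "N0 \<ge> 1"
    and xs_interior: "\<And>N. N \<ge> N0 \<Longrightarrow> xs N \<in> interior \<Omega>'"
    and xs_unique_max: "\<And>N x. N \<ge> N0 \<Longrightarrow> x \<in> \<Omega> \<Longrightarrow> x \<noteq> xs N \<Longrightarrow> f x N < f (xs N) N"
    and Delta: "(INF (N, x) \<in> {N0..} \<times> (\<Omega> - \<Omega>'). f (xs N) N - f x N) > 0"
    and xs_lim: "xs \<longlonglongrightarrow> xstar"
    and xstar: "xstar = 0"
    and inf_eigenvalue: "(INF (N, x) \<in> {N0..} \<times> \<Omega>'.
      min_abs_eigenvalue (hessian_within \<Omega>' (\<lambda>y. f y N) x)) > 0"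
    and inf_det: "(INF (N, x) \<in> {N0..} \<times> \<Omega>'.
      sqrt \<bar>det (hessian_within \<Omega>' (\<lambda>y. f y N) x)\<bar>) > 0"
    and sup_D2: "bdd_above ((\<lambda>(N, x). norm (Dwithin \<Omega>' (Dwithin \<Omega>' (\<lambda>y. f y N)) x))
      ` ({N0..} \<times> \<Omega>'))"
    and sup_D3: "bdd_above
      ((\<lambda>(N, x). norm (Dwithin \<Omega>' (Dwithin \<Omega>' (Dwithin \<Omega>' (\<lambda>y. f y N))) x))
      ` ({N0..} \<times> \<Omega>'))"
    and integrable_N: "\<And>N. N \<ge> N0 \<Longrightarrow> set_integrable lebesgue \<Omega> (\<lambda>x. exp (real N * f x N))"
    and integrable_N0: "\<And>N. N \<ge> N0 \<Longrightarrow> set_integrable lebesgue \<Omega> (\<lambda>x. exp (real N0 * f x N))"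
    and C: "C > 0" "\<And>N. N \<ge> N0 \<Longrightarrow> (LINT x:\<Omega>|lebesgue. exp (real N0 * f x N)) \<le> C"
    and f_eq: "\<And>N x. N \<ge> 1 \<Longrightarrow> x \<in> \<Omega> \<Longrightarrow> f x N = f0 x + \<epsilon> N * \<sigma> x"
    and f0_diff2: "twice_differentiable_at f0 xstar"
    and sigma_diff2: "twice_differentiable_at \<sigma> xstar"
    and f0_nonsingular: "invertible (hessian f0 xstar)"
    and eps_pos: "\<And>N. N \<ge> 1 \<Longrightarrow> \<epsilon> N > 0"
    and eps_small: "\<epsilon> \<in> o(\<lambda>N. 1 / sqrt (real N))"
    and P_prob: "\<And>N. N \<ge> N0 \<Longrightarrow> prob_space (P N)"
    and X_measurable: "\<And>N. N \<ge> N0 \<Longrightarrow> X N \<in> borel_measurable (P N)"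
    and X_in_Omega: "\<And>N \<omega>. N \<ge> N0 \<Longrightarrow> \<omega> \<in> space (P N) \<Longrightarrow> X N \<omega> \<in> \<Omega>"
    and X_distr: "\<And>N A. N \<ge> N0 \<Longrightarrow> A \<in> sets borel \<Longrightarrow> A \<subseteq> \<Omega> \<Longrightarrow>
      measure (P N) {\<omega> \<in> space (P N). X N \<omega> \<in> A} =
        (LINT x:A|lebesgue. exp (real N * f x N)) / (LINT x:\<Omega>|lebesgue. exp (real N * f x N))"
    and Z_def: "\<And>N \<omega>. Z N \<omega> = sqrt (real N) *\<^sub>R (xstar - X N \<omega>)"
  shows "weakly_converges (\<lambda>N. distr (P N) borel (Z N))
      (multivariate_normal 0 (- matrix_inv (hessian f0 xstar)))
    \<and> (\<forall>\<xi>. \<exists>a b :: nat \<Rightarrow> real. a \<in> O(\<lambda>_. 1) \<and> b \<in> O(\<lambda>_. 1) \<and>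
        (\<forall>N\<ge>N0. moment_generating_function (P N) (Z N) \<xi> =
          exp (- (1/2) * (\<xi> \<bullet> (matrix_inv (hessian f0 xstar) *v \<xi>))) *
            (1 + a N / sqrt (real N) + \<epsilon> N * sqrt (real N) * b N)))"
proof -
  obtain B0 where B0: "\<And>N x. N \<ge> 1 \<Longrightarrow> x \<in> \<Omega>' \<Longrightarrow>
      \<bar>f x N\<bar> \<le> B0 \<and> norm (Dwithin \<Omega>' (\<lambda>y. f y N) x) \<le> B0 \<and>
      norm (Dwithin \<Omega>' (Dwithin \<Omega>' (\<lambda>y. f y N)) x) \<le> B0 \<and>
      norm (Dwithin \<Omega>' (Dwithin \<Omega>' (Dwithin \<Omega>' (\<lambda>y. f y N))) x) \<le> B0"
    using unif_bounded by blast
  define B where "B = max B0 0"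
  have B: "B \<ge> 0" by (simp add: B_def)
  define g1 where "g1 N = Dwithin \<Omega>' (\<lambda>y. f y N)" for N
  define g2 where "g2 N = Dwithin \<Omega>' (g1 N)" for N
  have S: "convex \<Omega>'" "interior \<Omega>' \<noteq> {}" "0 \<in> \<Omega>'" "0 \<in> interior \<Omega>'" "\<Omega>' \<subseteq> \<Omega>"
    using Omega' by auto
  have C2: "C2_with_lipschitz_Hessian \<Omega>' B (\<lambda>x. f x N) (g1 N) (g2 N)" if "N \<ge> 1" for N
    unfolding g1_def g2_def
    by (rule C2_if_three_times_differentiable[OF diff3[OF that] S(1)]) (use B0[OF that] in \<open>force simp: B_def\<close>)
  have g2B: "norm (g2 N x) \<le> B" if "N \<ge> 1" "x \<in> \<Omega>'" for N x
    using B0[OF that] by (auto simp: g1_def g2_def B_def)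
  have sym: "g2 N x v w = g2 N x w v" if "N \<ge> 1" "x \<in> \<Omega>'" for N x v w
    by (rule second_derivative_symmetric[OF C2[OF that(1)] S(1,2) that(2) B])
  have hess: "hessian_within \<Omega>' (\<lambda>y. f y N) x = (\<chi> i j. g2 N x (axis i 1) (axis j 1))" for N x
    by (simp add: hessian_within_def g1_def g2_def)

  \<comment> \<open>The Hessians are uniformly negative definite on the whole ball, not only at the maximum.\<close>
  obtain d where d: "d > 0" "\<And>N x. N \<ge> N0 \<Longrightarrow> x \<in> \<Omega>' \<Longrightarrow> d \<le> \<bar>det (hessian_within \<Omega>' (\<lambda>y. f y N) x)\<bar>"
  proof -
    define I where "I = (INF (N, x) \<in> {N0..} \<times> \<Omega>'. sqrt \<bar>det (hessian_within \<Omega>' (\<lambda>y. f y N) x)\<bar>)"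
    have I: "I > 0" using inf_det by (simp add: I_def)
    have "I\<^sup>2 \<le> \<bar>det (hessian_within \<Omega>' (\<lambda>y. f y N) x)\<bar>" if "N \<ge> N0" "x \<in> \<Omega>'" for N x
    proof -
      have "I \<le> (\<lambda>(N, x). sqrt \<bar>det (hessian_within \<Omega>' (\<lambda>y. f y N) x)\<bar>) (N, x)"
        unfolding I_def using that by (intro cINF_lower bdd_belowI2[where m=0]) auto
      then have "I\<^sup>2 \<le> (sqrt \<bar>det (hessian_within \<Omega>' (\<lambda>y. f y N) x)\<bar>)\<^sup>2"
        using I by (intro power_mono) auto
      then show ?thesis by simp
    qed
    then show ?thesis using that[of "I\<^sup>2"] I by simp
  qed
  obtain lam where lam: "lam > 0"
    "\<And>(A::real^'m^'m) v. transpose A = A \<Longrightarrow> (\<And>i j. \<bar>A $ i $ j\<bar> \<le> B) \<Longrightarrow> \<bar>det A\<bar> \<ge> d \<Longrightarrow>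
      (\<And>v. v \<bullet> (A *v v) \<le> 0) \<Longrightarrow> v \<bullet> (A *v v) \<le> - lam * (norm v)\<^sup>2"
    using uniform_negative_definiteness[OF d(1), of B] by blast
  have gap: "g2 N x v v \<le> - lam * (norm v)\<^sup>2"
    if N: "N \<ge> N0" and x: "x \<in> \<Omega>'" and np: "\<And>v. g2 N x v v \<le> 0" for N x v
  proof -
    have N1: "N \<ge> 1" using N N0 by simp
    let ?A = "(\<chi> i j. g2 N x (axis i 1) (axis j 1)) :: real^'m^'m"
    have quad: "v \<bullet> (?A *v v) = g2 N x v v" for v by (rule second_derivative_matrix)
    have "v \<bullet> (?A *v v) \<le> - lam * (norm v)\<^sup>2"
    proof (rule lam(2))
      show "transpose ?A = ?A" by (rule transpose_second_derivative_matrix) (rule sym[OF N1 x])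
      show "\<bar>?A $ i $ j\<bar> \<le> B" for i j
        using abs_bilinear_le[of "g2 N x" "axis i 1" "axis j 1"] g2B[OF N1 x] by simp
      show "d \<le> \<bar>det ?A\<bar>" using d(2)[OF N x] by (simp add: hess)
      show "v \<bullet> (?A *v v) \<le> 0" for v unfolding quad by (rule np)
    qed
    then show ?thesis unfolding quad .
  qed
  have xsS: "xs N \<in> \<Omega>'" if "N \<ge> N0" for N using xs_interior[OF that] interior_subset by blast
  have max: "f x N \<le> f (xs N) N" if "N \<ge> N0" "x \<in> \<Omega>" for N x
    using xs_unique_max[OF that] by (cases "x = xs N") (auto intro: less_imp_le)
  have crit: "g1 N (xs N) = 0" "g2 N (xs N) v v \<le> 0" if "N \<ge> N0" for N v
    using second_derivative_nonpos_at_max[OF C2 S(1) xs_interior[OF that] B] max[OF that] that N0 S(5)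
    by (meson order_trans subsetD)+
  have nd: "g2 N x v v \<le> - lam * (norm v)\<^sup>2" if N: "N \<ge> N0" and x: "x \<in> \<Omega>'" for N x v
    by (rule negative_definite_propagates[OF C2 S(1) lam(1) gap[OF N] xsS[OF N] crit(2)[OF N] x])
      (use N N0 in auto)
  have quad_in: "f x N \<le> f (xs N) N - lam / 2 * (norm (x - xs N))\<^sup>2"
    and grad_in: "lam * norm (x - xs N) \<le> norm (g1 N x)" if N: "N \<ge> N0" and x: "x \<in> \<Omega>'" for N x
  proof -
    have N1: "N \<ge> 1" using N N0 by simp
    show "f x N \<le> f (xs N) N - lam / 2 * (norm (x - xs N))\<^sup>2" "lam * norm (x - xs N) \<le> norm (g1 N x)"
      by (rule strongly_concave_max[OF C2[OF N1] S(1) nd[OF N] xsS[OF N] crit(1)[OF N] x]; assumption)+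
  qed

  define \<Delta> where "\<Delta> = (INF (N, x) \<in> {N0..} \<times> (\<Omega> - \<Omega>'). f (xs N) N - f x N)"
  have \<Delta>: "\<Delta> > 0" using Delta by (simp add: \<Delta>_def)
  have out: "f x N \<le> f (xs N) N - \<Delta>" if "N \<ge> N0" "x \<in> \<Omega> - \<Omega>'" for N x
  proof -
    have "\<Delta> \<le> (\<lambda>(N, x). f (xs N) N - f x N) (N, x)"
      unfolding \<Delta>_def using that max by (intro cINF_lower bdd_belowI2[where m=0]) auto
    then show ?thesis by simp
  qed
  obtain R where R: "R > 0" "\<And>x. x \<in> \<Omega> \<Longrightarrow> norm x \<le> R"
    using Omega(2) bounded_pos by blast
  \<comment> \<open>One quadratic bound on all of \<open>\<Omega>\<close>: outside the ball, \<open>norm (x - xs N) \<le> 2 * R\<close> turns the gap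
    \<open>\<Delta>\<close> into a multiple of \<open>(norm (x - xs N))\<^sup>2\<close>.\<close>
  define k where "k = min (lam / 2) (\<Delta> / (2 * R)\<^sup>2)"
  have k: "k > 0" using lam(1) \<Delta> R(1) by (simp add: k_def)
  have quad: "f x N \<le> f (xs N) N - k * (norm (x - xs N))\<^sup>2" if N: "N \<ge> N0" and x: "x \<in> \<Omega>" for N x
  proof (cases "x \<in> \<Omega>'")
    case True
    have "k * (norm (x - xs N))\<^sup>2 \<le> lam / 2 * (norm (x - xs N))\<^sup>2"
      by (intro mult_right_mono) (auto simp: k_def)
    then show ?thesis using quad_in[OF N True] by linarith
  next
    case False
    have "norm (x - xs N) \<le> norm x + norm (xs N)" by (rule norm_triangle_ineq4)
    also have "\<dots> \<le> 2 * R" using R(2)[OF x] R(2)[of "xs N"] xsS[OF N] S(5) by auto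
    finally have "(norm (x - xs N))\<^sup>2 \<le> (2 * R)\<^sup>2" by (intro power_mono) auto
    then have "k * (norm (x - xs N))\<^sup>2 \<le> (\<Delta> / (2 * R)\<^sup>2) * (2 * R)\<^sup>2"
      using \<Delta> k by (intro mult_mono) (auto simp: k_def)
    also have "\<dots> = \<Delta>" using R(1) by simp
    finally show ?thesis using out[OF N, of x] x False by simp
  qed

  have eps_sqrt: "(\<lambda>N. \<epsilon> N * sqrt (real N)) \<longlonglongrightarrow> 0"
  proof -
    have "((\<lambda>N. \<epsilon> N / (1 / sqrt (real N))) \<longlongrightarrow> 0) sequentially"
      by (rule smalloD_tendsto[OF eps_small])
    then show ?thesis by simp
  qed
  have inv_sqrt: "(\<lambda>N. 1 / sqrt (real N)) \<longlonglongrightarrow> 0"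
    using tendsto_real_sqrt[OF lim_1_over_n] by (simp add: real_sqrt_divide)
  have eps0: "\<epsilon> \<longlonglongrightarrow> 0"
  proof -
    have "(\<lambda>N. \<epsilon> N * sqrt (real N) * (1 / sqrt (real N))) \<longlonglongrightarrow> 0"
      using tendsto_mult[OF eps_sqrt inv_sqrt] by simp
    then show ?thesis
      by (rule Lim_transform_eventually) (use eventually_gt_at_top[of 0] in eventually_elim, simp)
  qed
  have eps_nn: "\<epsilon> N \<ge> 0" if "N \<ge> N0" for N using eps_pos[of N] that N0 by simp

  \<comment> \<open>At the origin, the derivatives of \<open>\<lambda>x. f x N\<close> are those of \<open>f0\<close> up to \<open>\<epsilon> N\<close>.\<close>
  define F1 where "F1 = Dwithin UNIV f0 0"
  define s1 where "s1 = Dwithin UNIV \<sigma> 0"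
  define D where "D = Dwithin UNIV (Dwithin UNIV f0) 0"
  define s2 where "s2 = Dwithin UNIV (Dwithin UNIV \<sigma>) 0"
  have at0: "g1 N 0 = F1 + \<epsilon> N *\<^sub>R s1" "g2 N 0 = D + \<epsilon> N *\<^sub>R s2" if "N \<ge> N0" for N
    using derivatives_of_perturbation[OF C2 S(4), of N f0 "\<epsilon> N" \<sigma>] f_eq[of N] S(5) that N0
      f0_diff2 sigma_diff2 unfolding F1_def s1_def D_def s2_def xstar by auto
  have evN0: "\<forall>\<^sub>F N in sequentially. N \<ge> N0" by (rule eventually_ge_at_top)
  have F1: "F1 = 0"
  proof -
    have "norm F1 \<le> B * norm (xs N) + \<epsilon> N * norm s1" if N: "N \<ge> N0" for N
    proof -
      have "norm (g1 N 0 - g1 N (xs N)) \<le> B * norm (0 - xs N)"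
        using N N0 by (intro gradient_lipschitz[OF C2 S(1) g2B] S(3) xsS) auto
      then have *: "norm (F1 + \<epsilon> N *\<^sub>R s1) \<le> B * norm (xs N)"
        using crit(1)[OF N] at0(1)[OF N] by simp
      have "norm F1 = norm ((F1 + \<epsilon> N *\<^sub>R s1) - \<epsilon> N *\<^sub>R s1)" by simp
      also have "\<dots> \<le> norm (F1 + \<epsilon> N *\<^sub>R s1) + norm (\<epsilon> N *\<^sub>R s1)" by (rule norm_triangle_ineq4)
      finally show ?thesis using * eps_nn[OF N] by simp
    qed
    moreover have "(\<lambda>N. B * norm (xs N) + \<epsilon> N * norm s1) \<longlonglongrightarrow> B * norm (0::real^'m) + 0 * norm s1"
      using xs_lim unfolding xstar by (intro tendsto_intros eps0)
    ultimately have "norm F1 \<le> B * norm (0::real^'m) + 0 * norm s1"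
      by (intro LIMSEQ_le_const) auto
    then show ?thesis by simp
  qed
  \<comment> \<open>The maximum lies within \<open>O(\<epsilon> N)\<close> of the origin.\<close>
  define L where "L = norm s1 / lam"
  have L: "L \<ge> 0" using lam(1) by (simp add: L_def)
  have xs_eps: "norm (xs N) \<le> L * \<epsilon> N" if N: "N \<ge> N0" for N
    using grad_in[OF N S(3)] at0(1)[OF N] eps_nn[OF N] lam(1) by (simp add: F1 L_def field_simps)

  \<comment> \<open>\<open>D\<close> inherits symmetry and negative definiteness as the limit of \<open>g2 N 0\<close>.\<close>
  have Dsym: "D v w = D w v" for v w
  proof (rule LIMSEQ_unique)
    have eq: "g2 N 0 v w = D v w + \<epsilon> N * s2 v w" if "N \<ge> N0" for N v w
      using at0(2)[OF that] by (simp add: blinfun.add_left blinfun.scaleR_left)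
    have lim: "(\<lambda>N. D v w + \<epsilon> N * s2 v w) \<longlonglongrightarrow> D v w" for v w
      using tendsto_add[OF tendsto_const tendsto_mult[OF eps0 tendsto_const]] by simp
    show "(\<lambda>N. g2 N 0 v w) \<longlonglongrightarrow> D v w"
      by (rule Lim_transform_eventually[OF lim]) (use evN0 in eventually_elim, simp add: eq)
    show "(\<lambda>N. g2 N 0 v w) \<longlonglongrightarrow> D w v"
      by (rule Lim_transform_eventually[OF lim]) (use evN0 in eventually_elim, use N0 S(3) in \<open>simp add: eq[symmetric] sym\<close>)
  qed
  have Dneg: "D v v \<le> - lam * (norm v)\<^sup>2" for v
  proof -
    have "(\<lambda>N. D v v + \<epsilon> N * s2 v v) \<longlonglongrightarrow> D v v + 0 * s2 v v"
      by (intro tendsto_intros eps0)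
    moreover have "D v v + \<epsilon> N * s2 v v \<le> - lam * (norm v)\<^sup>2" if "N \<ge> N0" for N
      using nd[OF that S(3), of v] at0(2)[OF that] by (simp add: blinfun.add_left blinfun.scaleR_left)
    ultimately have "D v v + 0 * s2 v v \<le> - lam * (norm v)\<^sup>2"
      by (intro LIMSEQ_le_const2) auto
    then show ?thesis by simp
  qed
  have Dk: "D v v \<le> - 2 * k * (norm v)\<^sup>2" for v
  proof -
    have "2 * k * (norm v)\<^sup>2 \<le> lam * (norm v)\<^sup>2" by (intro mult_right_mono) (auto simp: k_def)
    then show ?thesis using Dneg[of v] by simp
  qed

  define A where "A = - hessian f0 xstar"
  have hessD: "hessian f0 xstar = (\<chi> i j. D (axis i 1) (axis j 1))"
    by (simp add: hessian_within_def D_def xstar)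
  have AD: "v \<bullet> (A *v w) = - D v w" for v w
  proof -
    have "A *v w = - (hessian f0 xstar *v w)"
      by (simp add: A_def matrix_vector_mult_def vec_eq_iff sum_negf)
    then show ?thesis by (simp add: hessD second_derivative_matrix)
  qed
  have symA: "transpose A = A"
    using transpose_second_derivative_matrix[of D, OF Dsym]
    by (simp add: A_def hessD transpose_def vec_eq_iff)
  have Ak: "v \<bullet> (A *v v) \<ge> 2 * k * (norm v)\<^sup>2" for v using Dk[of v] by (simp add: AD)
  have posA: "v \<bullet> (A *v v) > 0" if "v \<noteq> 0" for v
    by (rule less_le_trans[OF _ Ak]) (use k that in simp)
  have invA: "matrix_inv A = - matrix_inv (hessian f0 xstar)"
    unfolding A_def by (rule matrix_inv_uminus[OF f0_nonsingular])
  define \<gamma> where "\<gamma> = (\<lambda>y. exp (- (1/2) * (y \<bullet> (A *v y))))"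
  have \<gamma>D: "exp (1/2 * D y y) = \<gamma> y" for y by (simp add: \<gamma>_def AD)

  \<comment> \<open>The minus sign in \<open>x = xs N - y / sqrt N\<close> makes \<open>Z N = y - sqrt N *\<^sub>R xs N\<close>.\<close>
  define q where "q N y = (if xs N + (- 1 / sqrt N) *\<^sub>R y \<in> \<Omega>
      then exp (real N * (f (xs N + (- 1 / sqrt N) *\<^sub>R y) N - f (xs N) N)) else 0)" for N y
  have sqrtN: "- 1 / sqrt (real N) \<noteq> 0" if "N \<ge> N0" for N using that N0 by simp
  note E = expectation_rescaled[OF P_prob X_measurable X_in_Omega Omega(1) integrable_N X_distr]
  have q_meas: "q N \<in> borel_measurable lebesgue" if N: "N \<ge> N0" for N
    unfolding q_def
    by (rule E(1)[of N "\<lambda>_. 0"]) (use N sqrtN[OF N] in auto)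
  have expect: "(\<integral>\<omega>. h (X N \<omega>) \<partial>P N) =
      (\<integral>y. h (xs N + (- 1 / sqrt N) *\<^sub>R y) * q N y \<partial>lebesgue) / (\<integral>y. q N y \<partial>lebesgue)"
    if N: "N \<ge> N0" and h: "h \<in> borel_measurable borel" for N h
    unfolding q_def
    by (rule E(2)) (use N sqrtN[OF N] h in auto)

  define E' where "E' = B * L + norm s2"
  have E': "E' \<ge> 0" using B L by (simp add: E'_def)
  define K where "K = (B + 1 + 1 / (r / 2)) * (1 + E')"
  have K: "K \<ge> 0" using B E' Omega'(1) by (simp add: K_def)
  define \<delta> where "\<delta> N = 1 / sqrt (real N) + \<epsilon> N" for N
  have \<delta>: "\<delta> \<longlonglongrightarrow> 0" unfolding \<delta>_def using tendsto_add[OF inv_sqrt eps0] by simp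
  have "\<forall>\<^sub>F N in sequentially. dist (xs N) 0 < r / 2"
    using xs_lim Omega'(1) unfolding xstar by (intro tendstoD) auto
  with evN0 have q_close: "\<forall>\<^sub>F N in sequentially. q N \<in> borel_measurable lebesgue \<and>
      (\<forall>y. \<bar>q N y - \<gamma> y\<bar> \<le> K * \<delta> N * ((1 + norm y ^ 3) * exp (- k * (norm y)\<^sup>2)))"
  proof eventually_elim
    fix N assume N: "N \<ge> N0" and near: "dist (xs N) 0 < r / 2"
    have N1: "N \<ge> 1" using N N0 by simp
    have ball: "ball (xs N) (r / 2) \<subseteq> \<Omega>'"
    proof
      fix x assume "x \<in> ball (xs N) (r / 2)"
      then have "dist x 0 \<le> r" using near dist_triangle[of x 0 "xs N"] by (simp add: dist_commute)
      then show "x \<in> \<Omega>'" using Omega'(2) by (simp add: dist_commute)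
    qed
    have close: "norm (g2 N z - D) \<le> B * norm (z - xs N) + E' * \<epsilon> N" if z: "z \<in> \<Omega>'" for z
    proof -
      have "norm (g2 N z - D) = norm ((g2 N z - g2 N 0) + \<epsilon> N *\<^sub>R s2)" by (simp add: at0(2)[OF N])
      also have "\<dots> \<le> norm (g2 N z - g2 N 0) + norm (\<epsilon> N *\<^sub>R s2)" by (rule norm_triangle_ineq)
      also have "\<dots> \<le> B * norm z + \<epsilon> N * norm s2"
        using C2_lipschitzD[OF C2[OF N1] z S(3)] eps_nn[OF N] by simp
      also have "B * norm z \<le> B * (norm (z - xs N) + L * \<epsilon> N)"
        using norm_triangle_sub[of z "xs N"] xs_eps[OF N] by (intro mult_left_mono B) linarith
      finally show ?thesis by (simp add: E'_def algebra_simps)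
    qed
    have eN: "E' * \<epsilon> N \<ge> 0" using E' eps_nn[OF N] by simp
    have "\<bar>q N y - \<gamma> y\<bar> \<le> K * \<delta> N * ((1 + norm y ^ 3) * exp (- k * (norm y)\<^sup>2))" for y
    proof -
      have "\<bar>q N y - \<gamma> y\<bar> \<le> (B + 1 + 1 / (r / 2)) * (1 / sqrt (real N) + E' * \<epsilon> N)
          * ((1 + norm y ^ 3) * exp (- k * (norm y)\<^sup>2))"
        unfolding q_def \<gamma>D[symmetric]
        by (rule rescaled_density_estimate[OF C2[OF N1] S(1) B xsS[OF N] crit(1)[OF N] _ ball S(5) close eN quad[OF N] Dk])
          (use Omega'(1) N1 in auto)
      also have "\<dots> \<le> (B + 1 + 1 / (r / 2)) * ((1 + E') * \<delta> N) * ((1 + norm y ^ 3) * exp (- k * (norm y)\<^sup>2))"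
      proof (intro mult_right_mono mult_left_mono)
        have "E' * (1 / sqrt (real N)) \<ge> 0" using E' by simp
        then show "1 / sqrt (real N) + E' * \<epsilon> N \<le> (1 + E') * \<delta> N"
          using eps_nn[OF N] unfolding \<delta>_def distrib_left distrib_right by linarith
      qed (use B Omega'(1) in auto)
      finally show ?thesis by (simp add: K_def mult.assoc)
    qed
    then show "q N \<in> borel_measurable lebesgue \<and>
      (\<forall>y. \<bar>q N y - \<gamma> y\<bar> \<le> K * \<delta> N * ((1 + norm y ^ 3) * exp (- k * (norm y)\<^sup>2)))"
      using q_meas[OF N] by simp
  qed
  note ratio = normalized_integral_perturbation[OF \<gamma>_def symA posA k Ak K \<delta> _ q_close]

  have Zy: "sqrt (real N) *\<^sub>R (xstar - (xs N + (- 1 / sqrt N) *\<^sub>R y)) = - (sqrt (real N) *\<^sub>R xs N) + y"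
    if "N \<ge> N0" for N y
    using that N0 by (simp add: xstar algebra_simps)
  have shift: "(\<lambda>N. - (sqrt (real N) *\<^sub>R xs N)) \<longlonglongrightarrow> 0"
  proof (rule Lim_null_comparison)
    show "\<forall>\<^sub>F N in sequentially. norm (- (sqrt (real N) *\<^sub>R xs N)) \<le> L * (\<epsilon> N * sqrt (real N))"
      using evN0
    proof eventually_elim
      case (elim N)
      then show ?case using mult_left_mono[OF xs_eps[OF elim], of "sqrt (real N)"] by (simp add: mult_ac)
    qed
    show "(\<lambda>N. L * (\<epsilon> N * sqrt (real N))) \<longlonglongrightarrow> 0"
      using tendsto_mult[OF tendsto_const eps_sqrt] by simp
  qed

  have weak: "weakly_converges (\<lambda>N. distr (P N) borel (Z N))
      (multivariate_normal 0 (- matrix_inv (hessian f0 xstar)))"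
    unfolding weakly_converges_def
  proof (intro allI impI)
    fix g :: "real^'m \<Rightarrow> real" assume g: "continuous_on UNIV g \<and> bounded (range g)"
    then obtain c where c: "\<And>y. \<bar>g y\<bar> \<le> c" "c > 0" unfolding bounded_pos by auto
    have gm[measurable]: "g \<in> borel_measurable borel" using g by (intro borel_measurable_continuous_onI) simp
    define sh where "sh N = - (sqrt (real N) *\<^sub>R xs N)" for N
    obtain K' where K': "K' \<ge> 0" and ev: "\<forall>\<^sub>F N in sequentially. \<forall>h\<in>borel_measurable borel. \<forall>c\<ge>0.
        (\<forall>y. \<bar>h y\<bar> \<le> c * exp (0 * norm y)) \<longrightarrow>
        \<bar>(\<integral>y. h y * q N y \<partial>lebesgue) / (\<integral>y. q N y \<partial>lebesgue) - (\<integral>y. h y * \<gamma> y \<partial>lborel) / (\<integral>y. \<gamma> y \<partial>lborel)\<bar>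
          \<le> c * K' * \<delta> N"
      using ratio[of 0] by auto
    have integral_Z: "(\<integral>x. g x \<partial>distr (P N) borel (Z N)) =
        (\<integral>y. g (sh N + y) * q N y \<partial>lebesgue) / (\<integral>y. q N y \<partial>lebesgue)" if N: "N \<ge> N0" for N
    proof -
      have [measurable]: "X N \<in> borel_measurable (P N)" by (rule X_measurable[OF N])
      have Zm: "Z N \<in> borel_measurable (P N)"
        unfolding Z_def[abs_def] by measurable
      have "(\<integral>x. g x \<partial>distr (P N) borel (Z N)) = (\<integral>\<omega>. (\<lambda>x. g (sqrt (real N) *\<^sub>R (xstar - x))) (X N \<omega>) \<partial>P N)"
        by (subst integral_distr[OF Zm gm]) (simp add: Z_def)
      also have "\<dots> = (\<integral>y. g (sh N + y) * q N y \<partial>lebesgue) / (\<integral>y. q N y \<partial>lebesgue)"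
        by (subst expect[OF N]) (simp_all only: Zy[OF N] sh_def, measurable)
      finally show ?thesis .
    qed
    have \<gamma>int: "integrable lborel \<gamma>"
      using gaussian_integral(2)[OF symA posA] by (simp add: has_bochner_integral_iff \<gamma>_def)
    \<comment> \<open>The shift is handled for the limit density \<open>\<gamma>\<close>, where dominated convergence applies; the estimate
      \<open>ev\<close> is uniform in the weight and so covers the shifted \<open>g\<close>.\<close>
    have lim1: "(\<lambda>N. (\<integral>y. g (sh N + y) * \<gamma> y \<partial>lborel) / (\<integral>y. \<gamma> y \<partial>lborel))
        \<longlonglongrightarrow> (\<integral>y. g y * \<gamma> y \<partial>lborel) / (\<integral>y. \<gamma> y \<partial>lborel)"
      unfolding divide_inverse
      by (intro tendsto_mult tendsto_const tendsto_integral_shift[OF _ c(1) \<gamma>int])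
        (use g shift in \<open>simp_all add: sh_def\<close>)
    have lim2: "(\<lambda>N. (\<integral>x. g x \<partial>distr (P N) borel (Z N)) -
        (\<integral>y. g (sh N + y) * \<gamma> y \<partial>lborel) / (\<integral>y. \<gamma> y \<partial>lborel)) \<longlonglongrightarrow> 0"
    proof (rule Lim_null_comparison)
      show "\<forall>\<^sub>F N in sequentially. norm ((\<integral>x. g x \<partial>distr (P N) borel (Z N)) -
          (\<integral>y. g (sh N + y) * \<gamma> y \<partial>lborel) / (\<integral>y. \<gamma> y \<partial>lborel)) \<le> c * K' * \<delta> N"
        using ev evN0
      proof eventually_elim
        case (elim N)
        have "(\<lambda>y. g (sh N + y)) \<in> borel_measurable borel" by measurable
        then show ?case using elim(1) c unfolding integral_Z[OF elim(2)] by simp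
      qed
      show "(\<lambda>N. c * K' * \<delta> N) \<longlonglongrightarrow> 0"
        using tendsto_mult[OF tendsto_const \<delta>] by simp
    qed
    have limit: "(\<integral>x. g x \<partial>multivariate_normal 0 (- matrix_inv (hessian f0 xstar)))
        = (\<integral>y. g y * \<gamma> y \<partial>lborel) / (\<integral>y. \<gamma> y \<partial>lborel)"
      using integral_multivariate_normal[OF symA posA gm] by (simp add: invA \<gamma>_def)
    have "(\<lambda>N. \<integral>x. g x \<partial>distr (P N) borel (Z N)) \<longlonglongrightarrow> (\<integral>y. g y * \<gamma> y \<partial>lborel) / (\<integral>y. \<gamma> y \<partial>lborel)"
      using tendsto_add[OF lim2 lim1] by simp
    then show "(\<lambda>N. \<integral>x. g x \<partial>distr (P N) borel (Z N)) \<longlonglongrightarrow>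
        (\<integral>x. g x \<partial>multivariate_normal 0 (- matrix_inv (hessian f0 xstar)))"
      unfolding limit .
  qed

  have mgf: "\<exists>a b :: nat \<Rightarrow> real. a \<in> O(\<lambda>_. 1) \<and> b \<in> O(\<lambda>_. 1) \<and>
        (\<forall>N\<ge>N0. moment_generating_function (P N) (Z N) \<xi> =
          exp (- (1/2) * (\<xi> \<bullet> (matrix_inv (hessian f0 xstar) *v \<xi>))) *
            (1 + a N / sqrt (real N) + \<epsilon> N * sqrt (real N) * b N))" for \<xi>
  proof -
    define M where "M N = moment_generating_function (P N) (Z N) \<xi>" for N
    define G where "G = exp (- (1/2) * (\<xi> \<bullet> (matrix_inv (hessian f0 xstar) *v \<xi>)))"
    define \<rho> where "\<rho> N = 1 / sqrt (real N) + \<epsilon> N * sqrt (real N)" for N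
    \<comment> \<open>The relative error is distributed over both error terms with the same coefficient. The expansion is
      then an identity for every \<open>N \<ge> N0\<close>, and only the boundedness of \<open>a\<close> is asymptotic.\<close>
    define a where "a N = (M N / G - 1) / \<rho> N" for N
    define u where "u N = \<xi> \<bullet> (- (sqrt (real N) *\<^sub>R xs N))" for N
    have G: "G > 0" by (simp add: G_def)
    have \<rho>: "\<rho> N > 0" if "N \<ge> N0" for N
      using that N0 eps_nn[OF that] by (auto simp: \<rho>_def intro!: add_pos_nonneg)
    have eq: "M N = G * (1 + a N / sqrt (real N) + \<epsilon> N * sqrt (real N) * a N)" if "N \<ge> N0" for N
    proof -
      have "a N / sqrt (real N) + \<epsilon> N * sqrt (real N) * a N = \<rho> N * a N" by (simp add: \<rho>_def algebra_simps)
      also have "\<dots> = M N / G - 1" using \<rho>[OF that] by (simp add: a_def)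
      finally show ?thesis using G by (simp add: add.assoc)
    qed
    obtain K' where K': "K' \<ge> 0" and ev: "\<forall>\<^sub>F N in sequentially. \<forall>h\<in>borel_measurable borel. \<forall>c\<ge>0.
        (\<forall>y. \<bar>h y\<bar> \<le> c * exp (norm \<xi> * norm y)) \<longrightarrow>
        \<bar>(\<integral>y. h y * q N y \<partial>lebesgue) / (\<integral>y. q N y \<partial>lebesgue) - (\<integral>y. h y * \<gamma> y \<partial>lborel) / (\<integral>y. \<gamma> y \<partial>lborel)\<bar>
          \<le> c * K' * \<delta> N"
      using ratio[of "norm \<xi>"] by auto
    define Q where "Q N = (\<integral>y. exp (\<xi> \<bullet> y) * q N y \<partial>lebesgue) / (\<integral>y. q N y \<partial>lebesgue)" for N
    have \<gamma>pos: "(\<integral>y. \<gamma> y \<partial>lborel) > 0"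
      using gaussian_integral[OF symA posA] by (simp add: \<gamma>_def has_bochner_integral_iff)
    have "\<xi> \<bullet> (matrix_inv A *v \<xi>) = - (\<xi> \<bullet> (matrix_inv (hessian f0 xstar) *v \<xi>))"
      by (simp add: invA matrix_vector_mult_def sum_negf inner_vec_def)
    then have "(\<integral>y. exp (\<xi> \<bullet> y) * \<gamma> y \<partial>lborel) = G * (\<integral>y. \<gamma> y \<partial>lborel)"
      using gaussian_exponential_moment[OF symA posA, of \<xi>] by (simp add: G_def \<gamma>_def)
    then have QG: "(\<integral>y. exp (\<xi> \<bullet> y) * \<gamma> y \<partial>lborel) / (\<integral>y. \<gamma> y \<partial>lborel) = G"
      using \<gamma>pos by simp
    have MQ: "M N = exp (u N) * Q N" if N: "N \<ge> N0" for N
    proof -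
      have "M N = (\<integral>\<omega>. (\<lambda>x. exp (\<xi> \<bullet> (sqrt (real N) *\<^sub>R (xstar - x)))) (X N \<omega>) \<partial>P N)"
        by (simp add: M_def moment_generating_function_def Z_def)
      also have "\<dots> = (\<integral>y. exp (\<xi> \<bullet> (- (sqrt (real N) *\<^sub>R xs N) + y)) * q N y \<partial>lebesgue) / (\<integral>y. q N y \<partial>lebesgue)"
        by (subst expect[OF N]) (simp_all only: Zy[OF N], measurable)
      also have "\<dots> = (\<integral>y. exp (u N) * (exp (\<xi> \<bullet> y) * q N y) \<partial>lebesgue) / (\<integral>y. q N y \<partial>lebesgue)"
        by (simp add: u_def inner_diff_right exp_diff exp_minus field_simps)
      finally show ?thesis by (simp add: Q_def)
    qed
    define K2 where "K2 = exp 1 * K' / G + exp 1 * (norm \<xi> * L)"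
    have "(\<lambda>N. norm \<xi> * L * (\<epsilon> N * sqrt (real N))) \<longlonglongrightarrow> norm \<xi> * L * 0"
      by (intro tendsto_intros eps_sqrt)
    then have "\<forall>\<^sub>F N in sequentially. norm \<xi> * L * (\<epsilon> N * sqrt (real N)) < 1"
      by (intro order_tendstoD(2)) auto
    with ev evN0 have "\<forall>\<^sub>F N in sequentially. norm (a N) \<le> K2 * norm (1::real)"
    proof eventually_elim
      case (elim N)
      have e\<delta>: "\<delta> N \<le> \<rho> N" "\<epsilon> N * sqrt (real N) \<le> \<rho> N"
      proof -
        have "sqrt (real N) \<ge> 1" using elim(2) N0 by simp
        then have "\<epsilon> N * 1 \<le> \<epsilon> N * sqrt (real N)" using eps_nn[OF elim(2)] by (intro mult_left_mono) auto
        then show "\<delta> N \<le> \<rho> N" "\<epsilon> N * sqrt (real N) \<le> \<rho> N" by (auto simp: \<delta>_def \<rho>_def)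
      qed
      have "\<bar>Q N - G\<bar> \<le> 1 * K' * \<delta> N"
        unfolding QG[symmetric] Q_def
      proof (rule mp[OF spec[OF bspec[OF elim(1)], THEN mp]])
        show "\<forall>y. \<bar>exp (\<xi> \<bullet> y)\<bar> \<le> 1 * exp (norm \<xi> * norm y)"
          using norm_cauchy_schwarz[of \<xi>] by simp
      qed auto
      then have QN: "\<bar>Q N - G\<bar> \<le> K' * \<rho> N" using mult_left_mono[OF e\<delta>(1) K'] by linarith
      have "\<bar>u N\<bar> \<le> norm \<xi> * norm (sqrt (real N) *\<^sub>R xs N)"
        unfolding u_def using Cauchy_Schwarz_ineq2[of \<xi> "- (sqrt (real N) *\<^sub>R xs N)"] by simp
      also have "\<dots> \<le> norm \<xi> * (sqrt (real N) * (L * \<epsilon> N))"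
        using xs_eps[OF elim(2)] by (auto intro!: mult_left_mono)
      finally have uN: "\<bar>u N\<bar> \<le> norm \<xi> * L * (\<epsilon> N * sqrt (real N))" by (simp add: mult_ac)
      then have u1: "\<bar>u N\<bar> \<le> 1" using elim(3) by linarith
      have "\<bar>exp (u N) - exp 0\<bar> \<le> \<bar>u N - 0\<bar> * exp 1"
        by (rule abs_exp_diff_le) (use u1 in auto)
      also have "\<dots> \<le> (norm \<xi> * L * \<rho> N) * exp 1"
        using order_trans[OF uN mult_left_mono[OF e\<delta>(2), of "norm \<xi> * L"]] L by (intro mult_right_mono) auto
      finally have expu: "\<bar>exp (u N) - 1\<bar> \<le> exp 1 * (norm \<xi> * L) * \<rho> N" by (simp add: mult_ac)
      have split: "M N / G - 1 = exp (u N) * (Q N - G) / G + (exp (u N) - 1)"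
        using G by (simp add: MQ[OF elim(2)] field_simps)
      have "\<bar>M N / G - 1\<bar> \<le> \<bar>exp (u N) * (Q N - G) / G\<bar> + \<bar>exp (u N) - 1\<bar>"
        unfolding split by (rule abs_triangle_ineq)
      also have "\<dots> = exp (u N) * \<bar>Q N - G\<bar> / G + \<bar>exp (u N) - 1\<bar>"
        using G by (simp add: abs_mult)
      also have "\<dots> \<le> exp 1 * (K' * \<rho> N) / G + exp 1 * (norm \<xi> * L) * \<rho> N"
        using u1 G QN by (intro add_mono expu divide_right_mono mult_mono) auto
      also have "\<dots> = K2 * \<rho> N" by (simp add: K2_def algebra_simps)
      finally show ?case using \<rho>[OF elim(2)] by (simp add: a_def field_simps)
    qed
    then have "a \<in> O(\<lambda>_. 1)" by (rule bigoI)
    then show ?thesis using eq unfolding M_def G_def by (intro exI[of _ a]) auto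
  qed
  show ?thesis using weak mgf by blast
qed

end
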